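(* Let $X$ be a compact metric space, $T:X\to X$ continuous, and $\mu$ a $T$-invariant Borel probability measure on $X$ (not necessarily ergodic). Let $Z$ be an optimal reversible coding algorithm. Then for every finite measurable partition $\alpha$ of $X$, $$h_\mu(T,\alpha)=\int_XK_Z(x,\alpha)\,d\mu=\int_X\hat H(x,\alpha)\,d\mu=\int_XK(x,\alpha)\,d\mu.$$
   Context: For $\alpha=\{A_1,\dots,A_r\}$, $\varphi_\alpha(x)=\omega\in\{1,\dots,r\}^{\mathbb{N}}$ with $T^j(x)\in A_{\omega_j}$ for all $j$; $\omega^n$ is its first $n$ symbols. $K_Z(x,\alpha)=\limsup_n|Z(\omega^n)|/n$; $K(x,\alpha)=\limsup_nAIC(\omega^n)/n$, where $AIC(s)=\min\{|P|:C(P)=s\}$ for a fixed universal computing machine $C$; $\hat H(x,\alpha)=\lim_{l\to\infty}\limsup_n\hat H_l(\omega^n)$, where for a finite string $s$ of length $n$, $P(s,w)=\frac{1}{n-l+1}\#\{0\le i\le n-l:s_{i+1}\cdots s_{i+l}=w\}$ for $|w|=l$ and $\hat H_l(s)=-\frac1l\sum_wP(s,w)\log_2P(s,w)$. A reversible coding algorithm is an injective recursive map from finite strings to binary strings; it is optimal if for each $k$ there is $f_k$ with $f_k(n)=o(n)$ and $|Z(s)|/|s|\le\hat H_k(s)+f_k(|s|)/|s|$ for all finite $s$. $h_\mu(T,\alpha)$ is the Kolmogorov–Sinai entropy of $T$ relative to $\alpha$. *)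

theory Defs
  imports "HOL-Probability.Probability" "HOL-Library.Nat_Bijection" "HOL-Library.Landau_Symbols"
begin

datatype recf = Zero | Succ | Proj nat | Comp recf "recf list" | Prim recf recf | Mini recf

inductive eval :: "recf \<Rightarrow> nat list \<Rightarrow> nat \<Rightarrow> bool" where
  eval_Zero: "eval Zero xs 0"
| eval_Succ: "eval Succ (x # xs) (Suc x)"
| eval_Proj: "i < length xs \<Longrightarrow> eval (Proj i) xs (xs ! i)"
| eval_Comp: "list_all2 (\<lambda>g y. eval g xs y) gs ys \<Longrightarrow> eval f ys z \<Longrightarrow> eval (Comp f gs) xs z"
| eval_Prim0: "eval f xs y \<Longrightarrow> eval (Prim f g) (0 # xs) y"
| eval_PrimS: "eval (Prim f g) (n # xs) y \<Longrightarrow> eval g (y # n # xs) z \<Longrightarrow> eval (Prim f g) (Suc n # xs) z"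
| eval_Mini: "eval f (n # xs) 0 \<Longrightarrow> (\<forall>m<n. \<exists>y. y > 0 \<and> eval f (m # xs) y) \<Longrightarrow> eval (Mini f) xs n"

definition code_bits :: "bool list \<Rightarrow> nat" where
  "code_bits p = list_encode (map of_bool p)"

definition code_syms :: "nat list \<Rightarrow> nat" where
  "code_syms s = list_encode s"

definition partrec_prog :: "(bool list \<Rightarrow> nat list option) \<Rightarrow> bool" where
  "partrec_prog \<psi> \<longleftrightarrow> (\<exists>e. \<forall>p y. eval e [code_bits p] y \<longleftrightarrow> (\<exists>s. \<psi> p = Some s \<and> y = code_syms s))"

definition recursive_coder :: "(nat list \<Rightarrow> bool list) \<Rightarrow> bool" where
  "recursive_coder Z \<longleftrightarrow> (\<exists>e. \<forall>s. eval e [code_syms s] (code_bits (Z s)))"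

definition universal_machine :: "(bool list \<Rightarrow> nat list option) \<Rightarrow> bool" where
  "universal_machine C \<longleftrightarrow> partrec_prog C \<and>
     (\<forall>\<psi>. partrec_prog \<psi> \<longrightarrow> (\<exists>w. \<forall>p. C (w @ p) = \<psi> p))"

definition AIC :: "(bool list \<Rightarrow> nat list option) \<Rightarrow> nat list \<Rightarrow> nat" where
  "AIC C s = (LEAST n. \<exists>P. length P = n \<and> C P = Some s)"

text \<open>P(s,w) for |w| = l: frequency of w among the n-l+1 length-l windows of s (1-indexed in the paper).\<close>
definition emp_freq :: "nat list \<Rightarrow> nat list \<Rightarrow> real" where
  "emp_freq s w = real (card {i. i \<le> length s - length w \<and> take (length w) (drop i s) = w})
      / real (length s - length w + 1)"

definition emp_entropy :: "nat \<Rightarrow> nat list \<Rightarrow> real" where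
  "emp_entropy l s = - (1 / real l) *
     (\<Sum>w\<in>{w. length w = l \<and> set w \<subseteq> set s}. emp_freq s w * log 2 (emp_freq s w))"

definition reversible_coding :: "(nat list \<Rightarrow> bool list) \<Rightarrow> bool" where
  "reversible_coding Z \<longleftrightarrow> inj Z \<and> recursive_coder Z"

definition optimal_coding :: "(nat list \<Rightarrow> bool list) \<Rightarrow> bool" where
  "optimal_coding Z \<longleftrightarrow> reversible_coding Z \<and>
     (\<forall>r k. k \<ge> 1 \<longrightarrow> (\<exists>f :: nat \<Rightarrow> real. f \<in> o(\<lambda>n. real n) \<and>
        (\<forall>s. set s \<subseteq> {1..r} \<longrightarrow>
           real (length (Z s)) / real (length s) \<le> emp_entropy k s + f (length s) / real (length s))))"

definition meas_partition :: "'a measure \<Rightarrow> nat \<Rightarrow> (nat \<Rightarrow> 'a set) \<Rightarrow> bool" where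
  "meas_partition M r A \<longleftrightarrow> (\<forall>i\<in>{1..r}. A i \<in> sets M) \<and>
     (\<forall>i\<in>{1..r}. \<forall>j\<in>{1..r}. i \<noteq> j \<longrightarrow> A i \<inter> A j = {}) \<and> (\<Union>i\<in>{1..r}. A i) = space M"

definition symb :: "nat \<Rightarrow> (nat \<Rightarrow> 'a set) \<Rightarrow> 'a \<Rightarrow> nat" where
  "symb r A y = (THE i. i \<in> {1..r} \<and> y \<in> A i)"

definition itin :: "('a \<Rightarrow> 'a) \<Rightarrow> nat \<Rightarrow> (nat \<Rightarrow> 'a set) \<Rightarrow> 'a \<Rightarrow> nat \<Rightarrow> nat list" where
  "itin T r A x n = map (\<lambda>j. symb r A ((T ^^ j) x)) [0..<n]"

definition K_Z :: "(nat list \<Rightarrow> bool list) \<Rightarrow> ('a \<Rightarrow> 'a) \<Rightarrow> nat \<Rightarrow> (nat \<Rightarrow> 'a set) \<Rightarrow> 'a \<Rightarrow> real" where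
  "K_Z Z T r A x = real_of_ereal (limsup (\<lambda>n. ereal (real (length (Z (itin T r A x n))) / real n)))"

definition K_AIC :: "(bool list \<Rightarrow> nat list option) \<Rightarrow> ('a \<Rightarrow> 'a) \<Rightarrow> nat \<Rightarrow> (nat \<Rightarrow> 'a set) \<Rightarrow> 'a \<Rightarrow> real" where
  "K_AIC C T r A x = real_of_ereal (limsup (\<lambda>n. ereal (real (AIC C (itin T r A x n)) / real n)))"

definition H_hat :: "('a \<Rightarrow> 'a) \<Rightarrow> nat \<Rightarrow> (nat \<Rightarrow> 'a set) \<Rightarrow> 'a \<Rightarrow> real" where
  "H_hat T r A x = lim (\<lambda>l. real_of_ereal (limsup (\<lambda>n. ereal (emp_entropy l (itin T r A x n)))))"

text \<open>Entropy (base 2) of the join alpha v T^-1 alpha v ... v T^-(n-1) alpha, whose cells are the cylinders.\<close>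
definition join_entropy :: "'a measure \<Rightarrow> ('a \<Rightarrow> 'a) \<Rightarrow> nat \<Rightarrow> (nat \<Rightarrow> 'a set) \<Rightarrow> nat \<Rightarrow> real" where
  "join_entropy M T r A n = - (\<Sum>w\<in>{w. length w = n \<and> set w \<subseteq> {1..r}}.
      measure M {x\<in>space M. itin T r A x n = w} * log 2 (measure M {x\<in>space M. itin T r A x n = w}))"

definition KS_entropy :: "'a measure \<Rightarrow> ('a \<Rightarrow> 'a) \<Rightarrow> nat \<Rightarrow> (nat \<Rightarrow> 'a set) \<Rightarrow> real" where
  "KS_entropy M T r A = lim (\<lambda>n. join_entropy M T r A n / real n)"

end

(* Write h for the entropy rate, K, K_Z and H for the AIC, coder and empirical rates.
   Pointwise K <= K_Z, because a partial recursive decoder of Z is simulated by the universal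
   machine, and K_Z <= H almost everywhere by optimality.  Birkhoff's theorem makes the l-block
   frequencies converge to a shift-consistent family of distributions, so l times the l-block
   empirical entropy is subadditive in the limit, H is its Fekete limit, and concavity of
   -t log t bounds the integral of H by H(join of order l) / l for every l.  Conversely, distinct
   strings have distinct programs, so Gibbs' inequality bounds H(join of order n) by the mean of
   AIC plus O(log n), and a reverse Fatou argument gives limsup H(join of order n) / n <= int K.
   This closes the circle, so neither ergodicity nor an ergodic decomposition is used, and the
   existence of the limit defining h is a by-product. *)

theory Submission
  imports Defs "HOL-Real_Asymp.Real_Asymp"
begin

section \<open>Decoding and program length\<close>

text \<open>The two halves of the circle live on different levels. The bounds between
  \<open>K_AIC\<close>, \<open>K_Z\<close> and \<open>H_hat\<close> hold at almost every point,
  whereas the bounds against the entropy of a join hold only in the mean, because for a non-ergodic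
  measure the limiting frequencies depend on the point. Three difficulties shape the rest. The
  programs of \<open>C\<close> need not be prefix-free, so the weights 2^(-AIC) can have total mass
  above 1; over the words of length n the mass is still O(n), which is the origin of the O(log n)
  term. The rates are upper limits, and comparing their integrals with integrals at time n takes a
  uniform bound on the quotients; optimality at block length 1 supplies it for \<open>Z\<close>, and
  the simulation carries it over to \<open>AIC\<close>. Finally, \<open>limsup\<close> read as a
  real, \<open>lim\<close> and \<open>LEAST\<close> are total functions, so finiteness, convergence
  and existence of programs must be established before their values mean anything.\<close>

lemma eval_deterministic: "eval e xs y \<Longrightarrow> eval e xs z \<Longrightarrow> y = z"
proof (induction arbitrary: z rule: eval.induct)
  case (eval_Comp xs gs ys f z z')
  from eval_Comp.prems obtain ys' where ys': "list_all2 (\<lambda>g y. eval g xs y) gs ys'" "eval f ys' z'"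
    by (cases rule: eval.cases) auto
  have "ys' = ys"
  proof (rule nth_equalityI)
    show "length ys' = length ys"
      using list_all2_lengthD[OF eval_Comp.IH(1)] list_all2_lengthD[OF ys'(1)] by simp
    fix i assume "i < length ys'"
    with \<open>length ys' = length ys\<close> show "ys' ! i = ys ! i"
      using list_all2_nthD2[OF eval_Comp.IH(1), of i] list_all2_nthD2[OF ys'(1), of i] by simp
  qed
  with eval_Comp.IH(2) ys'(2) show ?case by simp
next
  case (eval_Mini f n xs)
  from eval_Mini.prems have z: "eval f (z # xs) 0" "\<forall>m<z. \<exists>y. y > 0 \<and> eval f (m # xs) y"
    by (cases rule: eval.cases; auto)+
  show ?case
  \<comment> \<open>The smaller of two distinct results would be a zero of \<open>f\<close> by one
    derivation and have a positive value by the other.\<close>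
  proof (rule linorder_cases[of n z])
    assume "n < z"
    then obtain y where "y > 0" "eval f (n # xs) y" using z(2) by blast
    with eval_Mini.IH(1) show ?thesis by fastforce
  next
    assume "z < n"
    then obtain y where "y > 0" "\<forall>z'. eval f (z # xs) z' \<longrightarrow> y = z'" using eval_Mini.IH(2) by blast
    with z(1) show ?thesis by fastforce
  qed
next
  case (eval_PrimS f g n xs y z z')
  from eval_PrimS.prems show ?case
    by (cases rule: eval.cases) (use eval_PrimS.IH in fastforce)
next
  case (eval_Prim0 f xs y g)
  from eval_Prim0.prems show ?case
    by (cases rule: eval.cases) (use eval_Prim0.IH in fastforce)
next
  case (eval_Zero xs)
  then show ?case by (cases rule: eval.cases) auto
next
  case (eval_Succ x xs)
  then show ?case by (cases rule: eval.cases) auto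
next
  case (eval_Proj i xs)
  from eval_Proj(2) show ?case by (cases rule: eval.cases) auto
qed

section \<open>Recursive arithmetic for an equality test\<close>

definition recf_pred :: recf where "recf_pred = Prim Zero (Proj 1)"
text \<open>\<open>Prim\<close> recurses on the first argument and hands its step the previous value
  followed by the counter. Hence \<open>recf_sub\<close> subtracts its first argument from its
  second.\<close>

definition recf_sub :: recf where "recf_sub = Prim (Proj 0) (Comp recf_pred [Proj 0])"
definition recf_add :: recf where "recf_add = Prim (Proj 0) (Comp Succ [Proj 0])"

lemma eval_ProjI: "i < length xs \<Longrightarrow> y = xs ! i \<Longrightarrow> eval (Proj i) xs y"
  using eval_Proj by simp

lemma eval_recf_pred: "eval recf_pred [n] (n - 1)"
proof (induction n)
  case 0 show ?case unfolding recf_pred_def by (auto intro: eval.intros)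
next
  case (Suc n)
  then show ?case unfolding recf_pred_def by (auto intro!: eval_PrimS eval_ProjI)
qed

lemma eval_recf_sub: "eval recf_sub [n, b] (b - n)"
proof (induction n)
  case 0 show ?case unfolding recf_sub_def by (auto intro!: eval_Prim0 eval_ProjI)
next
  case (Suc n)
  have "eval (Comp recf_pred [Proj 0]) [b - n, n, b] (b - Suc n)"
    by (rule eval_Comp[where ys = "[b - n]"])
      (use eval_recf_pred[of "b - n"] in \<open>auto intro!: eval_ProjI\<close>)
  with Suc show ?case unfolding recf_sub_def by (auto intro: eval_PrimS)
qed

lemma eval_recf_add: "eval recf_add [n, b] (n + b)"
proof (induction n)
  case 0 show ?case unfolding recf_add_def by (auto intro!: eval_Prim0 eval_ProjI)
next
  case (Suc n)
  have "eval (Comp Succ [Proj 0]) [n + b, n, b] (Suc n + b)"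
    by (rule eval_Comp[where ys = "[n + b]"]) (auto intro!: eval_ProjI eval_Succ)
  with Suc show ?case unfolding recf_add_def by (auto intro: eval_PrimS)
qed

text \<open>\<open>Mini\<close> searches for zeros, so equality has to be tested by a number that
  vanishes exactly when the arguments agree: the sum of the two truncated differences is |a -
  b|.\<close>

definition recf_dist :: recf where
  "recf_dist = Comp recf_add [Comp recf_sub [Proj 0, Proj 1], Comp recf_sub [Proj 1, Proj 0]]"

lemma eval_recf_dist: "eval recf_dist [a, b] ((b - a) + (a - b))"
  unfolding recf_dist_def
proof (rule eval_Comp[where ys = "[b - a, a - b]"])
  have "eval (Comp recf_sub [Proj 0, Proj 1]) [a, b] (b - a)"
    by (rule eval_Comp[where ys = "[a, b]"]) (auto intro!: eval_recf_sub eval_ProjI)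
  moreover have "eval (Comp recf_sub [Proj 1, Proj 0]) [a, b] (a - b)"
    by (rule eval_Comp[where ys = "[b, a]"]) (auto intro!: eval_recf_sub eval_ProjI)
  ultimately show "list_all2 (\<lambda>g y. eval g [a, b] y)
      [Comp recf_sub [Proj 0, Proj 1], Comp recf_sub [Proj 1, Proj 0]] [b - a, a - b]"
    by simp
qed (rule eval_recf_add)

lemma code_bits_eq_iff: "code_bits p = code_bits q \<longleftrightarrow> p = q"
proof -
  have "inj (of_bool :: bool \<Rightarrow> nat)" by (auto simp: inj_def)
  then show ?thesis unfolding code_bits_def by (metis inj_map_eq_map list_encode_inverse)
qed

text \<open>The decoder searches for the least string code whose coding is the given input;
  totality of the coder makes the unbounded search well defined.\<close>

lemma partrec_prog_decoder:
  assumes inj: "inj Z" and Z: "recursive_coder Z"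
  shows "partrec_prog (\<lambda>p. if p \<in> range Z then Some (inv Z p) else None)"
proof -
  obtain e where e: "\<And>s. eval e [code_syms s] (code_bits (Z s))"
    using Z unfolding recursive_coder_def by blast
  \<comment> \<open>\<open>list_encode\<close> is a bijection onto the naturals, so a search through
    all numbers is a search through all strings.\<close>
  define c where "c n = code_bits (Z (list_decode n))" for n
  have ec: "eval e [n] (c n)" for n
    using e[of "list_decode n"] by (simp add: c_def code_syms_def)
  define f where "f = Comp recf_dist [Comp e [Proj 0], Proj 1]"
  have f: "eval f [n, x] ((x - c n) + (c n - x))" for n x
    unfolding f_def
    by (rule eval_Comp[where ys = "[c n, x]"])
      (auto intro!: eval_recf_dist eval_Comp[where ys = "[n]"] eval_ProjI ec)
  \<comment> \<open>\<open>partrec_prog\<close> is an equivalence, so outputs other than the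
    intended one must be excluded; this is where determinism of \<open>eval\<close> enters.\<close>
  have f0: "eval f [n, x] y \<longleftrightarrow> y = (x - c n) + (c n - x)" for n x y
    using f eval_deterministic by blast
  have "eval (Mini f) [code_bits p] y \<longleftrightarrow>
      (\<exists>s. (if p \<in> range Z then Some (inv Z p) else None) = Some s \<and> y = code_syms s)" for p y
  proof
    assume "eval (Mini f) [code_bits p] y"
    then have "eval f [y, code_bits p] 0" by (cases rule: eval.cases) auto
    then have "c y = code_bits p" unfolding f0 by simp
    then have "Z (list_decode y) = p" by (simp add: c_def code_bits_eq_iff)
    then show "\<exists>s. (if p \<in> range Z then Some (inv Z p) else None) = Some s \<and> y = code_syms s"
      using inj by (auto simp: code_syms_def inj_eq intro!: exI[of _ "list_decode y"])
  next
    assume "\<exists>s. (if p \<in> range Z then Some (inv Z p) else None) = Some s \<and> y = code_syms s"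
    then have p: "Z (list_decode y) = p"
      by (auto simp: code_syms_def f_inv_into_f split: if_splits)
    have "c m \<noteq> code_bits p" if "m < y" for m
    proof
      assume "c m = code_bits p"
      then have "Z (list_decode m) = Z (list_decode y)" by (simp add: c_def code_bits_eq_iff p)
      then have "list_encode (list_decode m) = list_encode (list_decode y)"
        using inj by (simp add: inj_eq)
      with that show False by simp
    qed
    then have "\<forall>m<y. \<exists>z. z > 0 \<and> eval f [m, code_bits p] z"
      unfolding f0 by (auto simp: neq_iff)
    moreover have "eval f [y, code_bits p] 0"
      unfolding f0 by (simp add: c_def p)
    ultimately show "eval (Mini f) [code_bits p] y" by (intro eval_Mini)
  qed
  then show ?thesis unfolding partrec_prog_def by blast
qed

text \<open>The constant is the length of the prefix that makes \<open>C\<close> run the decoder.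
  The second conclusion is recorded because \<open>LEAST\<close> over an empty set says nothing: it
  gives every string a program that attains its \<open>AIC\<close>.\<close>

lemma AIC_le_length_coding:
  assumes "reversible_coding Z" and C: "universal_machine C"
  obtains c where "\<And>s. AIC C s \<le> length (Z s) + c" "\<And>s. \<exists>P. C P = Some s"
proof -
  have inj: "inj Z" and "recursive_coder Z" using assms by (auto simp: reversible_coding_def)
  then obtain w where w: "\<And>p. C (w @ p) = (if p \<in> range Z then Some (inv Z p) else None)"
    using C partrec_prog_decoder unfolding universal_machine_def by blast
  have P: "C (w @ Z s) = Some s" for s using inj by (simp add: w)
  have "AIC C s \<le> length (Z s) + length w" for s
    unfolding AIC_def by (rule Least_le) (use P in \<open>auto intro!: exI[of _ "w @ Z s"]\<close>)
  with P show ?thesis using that by blast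
qed

section \<open>Counting strings by complexity\<close>

lemma AIC_program:
  assumes "\<exists>P. C P = Some s"
  shows "\<exists>P. length P = AIC C s \<and> C P = Some s"
  unfolding AIC_def by (rule LeastI_ex) (use assms in auto)

text \<open>A substitute for Kraft's inequality without prefix-freeness. At most 2^k strings have
  complexity k, so each of the N + 1 possible complexities contributes at most 1.\<close>

lemma sum_AIC_le:
  assumes "finite S" and ex: "\<And>s. s \<in> S \<Longrightarrow> \<exists>P. C P = Some s"
    and le: "\<And>s. s \<in> S \<Longrightarrow> AIC C s \<le> N"
  shows "(\<Sum>s\<in>S. 2 powr (- real (AIC C s))) \<le> real N + 1"
proof -
  obtain P where P: "\<And>s. s \<in> S \<Longrightarrow> length (P s) = AIC C s \<and> C (P s) = Some s"
    using AIC_program[OF ex] by metis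
  have card: "card {s\<in>S. AIC C s = k} \<le> 2 ^ k" for k
  proof -
    have "card {s\<in>S. AIC C s = k} \<le> card {xs :: bool list. set xs \<subseteq> UNIV \<and> length xs = k}"
    proof (rule card_inj_on_le)
      show "inj_on P {s\<in>S. AIC C s = k}"
        using P by (metis (mono_tags, lifting) inj_onI mem_Collect_eq option.inject)
      show "P ` {s\<in>S. AIC C s = k} \<subseteq> {xs. set xs \<subseteq> UNIV \<and> length xs = k}" using P by auto
    qed (rule finite_lists_length_eq, simp)
    then show ?thesis using card_lists_length_eq[of "UNIV :: bool set" k] by simp
  qed
  have "(\<Sum>s\<in>S. 2 powr (- real (AIC C s))) =
      (\<Sum>k\<in>{..N}. \<Sum>s | s \<in> S \<and> AIC C s = k. 2 powr (- real (AIC C s)))"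
    using assms by (intro sum.group[symmetric]) auto
  also have "\<dots> = (\<Sum>k\<in>{..N}. real (card {s\<in>S. AIC C s = k}) * 2 powr (- real k))"
    by (intro sum.cong) auto
  also have "\<dots> \<le> (\<Sum>k\<in>{..N}. 1)"
  proof (rule sum_mono)
    fix k
    have "real (card {s\<in>S. AIC C s = k}) \<le> 2 powr real k"
      using of_nat_mono[OF card[of k], where 'a = real] by (simp add: powr_realpow)
    then have "real (card {s\<in>S. AIC C s = k}) * 2 powr (- real k) \<le> 2 powr real k * 2 powr (- real k)"
      by (intro mult_right_mono) auto
    also have "\<dots> = 1" by (simp add: powr_minus)
    finally show "real (card {s\<in>S. AIC C s = k}) * 2 powr (- real k) \<le> 1" .
  qed
  finally show ?thesis by simp
qed

section \<open>Entropy and limits\<close>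

text \<open>The weights \<open>q\<close> may have any total mass, and the last term pays for
  normalising them; this admits both 2^(-AIC) and product distributions. The positivity condition is
  absolute continuity: \<open>log\<close> has no infinite value that a cell with p > 0 = q could
  contribute. Termwise the proof is ln t \<le> t - 1.\<close>

lemma gibbs_inequality:
  fixes p q :: "'i \<Rightarrow> real"
  assumes "finite I" and p: "\<And>i. i \<in> I \<Longrightarrow> 0 \<le> p i" "sum p I = 1"
    and q: "\<And>i. i \<in> I \<Longrightarrow> 0 \<le> q i" "\<And>i. i \<in> I \<Longrightarrow> 0 < p i \<Longrightarrow> 0 < q i"
  shows "- (\<Sum>i\<in>I. p i * log 2 (p i)) \<le> - (\<Sum>i\<in>I. p i * log 2 (q i)) + log 2 (sum q I)"
proof -
  define Q where "Q = sum q I"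
  obtain j where j: "j \<in> I" "0 < p j"
    using p by (metis less_eq_real_def sum.neutral zero_neq_one)
  have "0 < Q" unfolding Q_def
    by (rule sum_pos2[OF \<open>finite I\<close> j(1)]) (use j q in auto)
  have "p i * log 2 (q i) - p i * log 2 (p i) - p i * log 2 Q \<le> (q i / Q - p i) / ln 2"
    if i: "i \<in> I" for i
  proof (cases "p i = 0")
    case True
    then show ?thesis using q(1)[OF i] \<open>0 < Q\<close> by simp
  next
    case False
    then have pos: "0 < p i" "0 < q i" using p(1)[OF i] q(2)[OF i] by auto
    have "ln (q i / (p i * Q)) \<le> q i / (p i * Q) - 1"
      using pos \<open>0 < Q\<close> by (intro ln_le_minus_one) auto
    then have "p i * ln (q i / (p i * Q)) \<le> p i * (q i / (p i * Q) - 1)"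
      using pos by (intro mult_left_mono) auto
    also have "\<dots> = q i / Q - p i" using pos \<open>0 < Q\<close> by (simp add: field_simps)
    finally have "p i * (ln (q i) - ln (p i) - ln Q) / ln 2 \<le> (q i / Q - p i) / ln 2"
      using pos \<open>0 < Q\<close> by (simp add: ln_div ln_mult divide_right_mono algebra_simps)
    then show ?thesis by (simp add: log_def algebra_simps diff_divide_distrib add_divide_distrib)
  qed
  then have "(\<Sum>i\<in>I. p i * log 2 (q i) - p i * log 2 (p i) - p i * log 2 Q)
      \<le> (\<Sum>i\<in>I. (q i / Q - p i) / ln 2)"
    by (rule sum_mono)
  also have "\<dots> = (sum q I / Q - sum p I) / ln 2"
    by (simp add: sum_subtractf flip: sum_divide_distrib)
  also have "\<dots> = 0" using \<open>0 < Q\<close> p(2) by (simp add: Q_def)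
  finally show ?thesis
    using p(2) by (simp add: sum_subtractf Q_def flip: sum_distrib_right)
qed

text \<open>Write n as q * l plus a remainder below l, whose contribution is bounded by the constant
  \<open>B\<close>. The limit is the infimum of the quotients; the second conclusion keeps this, so
  that the limit can later be bounded by a quotient at one fixed index.\<close>

lemma fekete_subadditive:
  fixes a :: "nat \<Rightarrow> real"
  assumes nonneg: "\<And>n. 0 \<le> a n" and sub: "\<And>m n. a (m + n) \<le> a m + a n"
  obtains L where "(\<lambda>n. a n / real n) \<longlonglongrightarrow> L" "\<And>n. 1 \<le> n \<Longrightarrow> L \<le> a n / real n"
proof -
  define L where "L = (INF n\<in>{1..}. a n / real n)"
  have bdd: "bdd_below ((\<lambda>n. a n / real n) ` {1..})"
    by (rule bdd_belowI[of _ 0]) (auto simp: nonneg)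
  have L: "L \<le> a n / real n" if "1 \<le> n" for n
    unfolding L_def using that by (intro cINF_lower[OF bdd]) auto
  have mult: "a (q * l + i) \<le> real q * a l + a i" for q l i
  proof (induction q)
    case (Suc q)
    have "a (Suc q * l + i) \<le> a l + a (q * l + i)" using sub[of l "q * l + i"] by (simp add: add.assoc)
    with Suc show ?case by (simp add: algebra_simps)
  qed simp
  have "(\<lambda>n. a n / real n) \<longlonglongrightarrow> L"
  proof (rule LIMSEQ_I)
    fix e :: real assume "0 < e"
    obtain l where l: "1 \<le> l" "a l / real l < L + e / 2"
      using cINF_less_iff[OF _ bdd, of "L + e / 2"] \<open>0 < e\<close> unfolding L_def by auto
    define B where "B = (\<Sum>i<l. a i)"
    have B: "a i \<le> B" if "i < l" for i
      unfolding B_def using that by (intro member_le_sum) (auto simp: nonneg)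
    have "0 \<le> B" unfolding B_def by (simp add: sum_nonneg nonneg)
    have "eventually (\<lambda>n. B / real n < e / 2) sequentially"
      by (rule order_tendstoD(2)[OF lim_const_over_n]) (use \<open>0 < e\<close> in simp)
    then obtain N where N: "\<And>n. n \<ge> N \<Longrightarrow> B / real n < e / 2"
      unfolding eventually_sequentially by blast
    have "norm (a n / real n - L) < e" if "n \<ge> max N 1" for n
    proof -
      have n: "n \<ge> N" "n \<ge> 1" using that by auto
      have "a n \<le> real (n div l) * a l + a (n mod l)" using mult[of "n div l" l "n mod l"] by simp
      also have "\<dots> \<le> (real n / real l) * a l + B"
        using l(1) by (intro add_mono mult_right_mono B) (auto simp: nonneg of_nat_div_le_of_nat)
      finally have "a n / real n \<le> ((real n / real l) * a l + B) / real n"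
        by (rule divide_right_mono) simp
      also have "\<dots> = a l / real l + B / real n" using n l by (simp add: field_simps)
      also have "\<dots> < L + e" using l(2) N[OF n(1)] by linarith
      finally show ?thesis using L[OF n(2)] by simp
    qed
    then show "\<exists>N. \<forall>n\<ge>N. norm (a n / real n - L) < e" by blast
  qed
  with L show ?thesis using that by blast
qed

text \<open>The shape shared by all rates in the statement. \<open>real_of_ereal\<close> sends both
  infinities to 0, so the comparisons below carry bounds that keep the upper limit finite.\<close>

definition real_limsup :: "(nat \<Rightarrow> real) \<Rightarrow> real" where
  "real_limsup u = real_of_ereal (limsup (\<lambda>n. ereal (u n)))"

lemma ereal_real_limsup:
  assumes "\<And>n. 0 \<le> u n" "\<And>n. u n \<le> B"
  shows "ereal (real_limsup u) = limsup (\<lambda>n. ereal (u n))"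
proof -
  have "limsup (\<lambda>n. ereal (u n)) \<le> ereal B"
    by (rule Limsup_bounded) (use assms in auto)
  moreover have "ereal 0 \<le> liminf (\<lambda>n. ereal (u n))"
    by (rule Liminf_bounded) (use assms in auto)
  moreover have "liminf (\<lambda>n. ereal (u n)) \<le> limsup (\<lambda>n. ereal (u n))"
    by (rule Liminf_le_Limsup) simp
  ultimately have "ereal 0 \<le> limsup (\<lambda>n. ereal (u n))" "limsup (\<lambda>n. ereal (u n)) \<le> ereal B"
    by (blast intro: order_trans)+
  then show ?thesis unfolding real_limsup_def by (cases "limsup (\<lambda>n. ereal (u n))") auto
qed

lemma real_limsup_bounds:
  assumes "\<And>n. 0 \<le> u n" "\<And>n. u n \<le> B"
  shows "0 \<le> real_limsup u" "real_limsup u \<le> B"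
proof -
  note eq = ereal_real_limsup[of u B, OF assms]
  have "limsup (\<lambda>n. ereal (u n)) \<le> ereal B"
    by (rule Limsup_bounded) (use assms in auto)
  then show "real_limsup u \<le> B" unfolding eq[symmetric] by simp
  have "ereal 0 \<le> liminf (\<lambda>n. ereal (u n))"
    by (rule Liminf_bounded) (use assms in auto)
  also have "\<dots> \<le> limsup (\<lambda>n. ereal (u n))"
    by (rule Liminf_le_Limsup) simp
  finally show "0 \<le> real_limsup u" unfolding eq[symmetric] by simp
qed

lemma real_limsup_eq_lim:
  assumes "v \<longlonglongrightarrow> L"
  shows "real_limsup v = L"
proof -
  have "limsup (\<lambda>n. ereal (v n)) = ereal L"
    by (rule lim_imp_Limsup) (use assms in auto)
  then show ?thesis by (simp add: real_limsup_def)
qed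

text \<open>The null sequence \<open>d\<close> absorbs the overhead c / n of a simulation and the
  sublinear error of an optimal coder.\<close>

lemma real_limsup_mono:
  assumes u: "\<And>n. 0 \<le> u n" "\<And>n. u n \<le> B" and v: "\<And>n. 0 \<le> v n" "\<And>n. v n \<le> B'"
    and le: "\<And>n. u n \<le> d n + v n" and d: "d \<longlonglongrightarrow> 0"
  shows "real_limsup u \<le> real_limsup v"
proof -
  have d': "(\<lambda>n. ereal (d n)) \<longlonglongrightarrow> 0" using d by (simp add: zero_ereal_def)
  have "limsup (\<lambda>n. ereal (u n)) \<le> limsup (\<lambda>n. ereal (d n) + ereal (v n))"
    by (rule Limsup_mono) (use le in auto)
  also have "\<dots> = limsup (\<lambda>n. ereal (v n))"
    by (subst ereal_limsup_lim_add[OF d']) auto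
  finally show ?thesis
    unfolding ereal_real_limsup[of u B, OF u, symmetric] ereal_real_limsup[of v B', OF v, symmetric]
    by simp
qed

lemma eventually_less_real_limsup:
  assumes "\<And>n. 0 \<le> u n" "\<And>n. u n \<le> B" "0 < e"
  shows "\<forall>\<^sub>F n in sequentially. u n < real_limsup u + e"
proof -
  have "limsup (\<lambda>n. ereal (u n)) < ereal (real_limsup u + e)"
    unfolding ereal_real_limsup[of u B, OF assms(1,2), symmetric] using assms by simp
  from Limsup_lessD[OF this] show ?thesis by simp
qed

lemma real_limsup_measurable[measurable (raw)]:
  assumes [measurable]: "\<And>n. u n \<in> borel_measurable M"
  shows "(\<lambda>x. real_limsup (\<lambda>n. u n x)) \<in> borel_measurable M"
  unfolding real_limsup_def by measurable

text \<open>The upper bound is crude, the true maximum being 1 / (e ln 2); it serves only as a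
  uniform dominating constant.\<close>

lemma neg_mult_log_bounds:
  fixes t :: real
  assumes "0 \<le> t" "t \<le> 1"
  shows "0 \<le> - (t * log 2 t)" "- (t * log 2 t) \<le> 1 / ln 2"
proof -
  show "0 \<le> - (t * log 2 t)"
    using assms by (cases "t = 0") (auto simp: mult_le_0_iff)
  show "- (t * log 2 t) \<le> 1 / ln 2"
  proof (cases "t = 0")
    case False
    then have "0 < t" using assms by simp
    have "ln (1 / t) \<le> 1 / t - 1" using \<open>0 < t\<close> by (intro ln_le_minus_one) simp
    then have "t * (- ln t) \<le> t * (1 / t - 1)"
      using \<open>0 < t\<close> by (intro mult_left_mono) (auto simp: ln_div)
    also have "\<dots> \<le> 1" using \<open>0 < t\<close> by (simp add: field_simps)
    finally have "t * (- ln t) / ln 2 \<le> 1 / ln 2" by (rule divide_right_mono) simp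
    then show ?thesis by (simp add: log_def)
  qed simp
qed

section \<open>Reverse Fatou and Jensen inequalities\<close>

context prob_space begin

text \<open>The positive part of \<open>u n\<close> minus the upper limit tends to 0 pointwise,
  though the difference itself need not, and it lies between 0 and \<open>B\<close>. Dominated
  convergence makes its integral small.\<close>

lemma integral_le_real_limsup:
  fixes u :: "nat \<Rightarrow> 'a \<Rightarrow> real"
  assumes [measurable]: "\<And>n. u n \<in> borel_measurable M"
    and u: "\<And>n x. x \<in> space M \<Longrightarrow> 0 \<le> u n x" "\<And>n x. x \<in> space M \<Longrightarrow> u n x \<le> B"
    and "0 < e"
  shows "\<forall>\<^sub>F n in sequentially. (\<integral>x. u n x \<partial>M) \<le> (\<integral>x. real_limsup (\<lambda>n. u n x) \<partial>M) + e"
proof -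
  define U where "U x = real_limsup (\<lambda>n. u n x)" for x
  have [measurable]: "U \<in> borel_measurable M" unfolding U_def by measurable
  have U: "0 \<le> U x" "U x \<le> B" if "x \<in> space M" for x
    unfolding U_def using real_limsup_bounds[of "\<lambda>n. u n x" B] u that by auto
  have intU: "integrable M U" "integrable M (u n)" for n
    by (rule integrable_const_bound[where B = B]; use U u in \<open>auto intro!: AE_I2\<close>)+
  have "(\<lambda>n. \<integral>x. max 0 (u n x - U x) \<partial>M) \<longlonglongrightarrow> (\<integral>x. 0 \<partial>M)"
  proof (rule integral_dominated_convergence[where w = "\<lambda>_. B"])
    show "AE x in M. (\<lambda>n. max 0 (u n x - U x)) \<longlonglongrightarrow> 0"
    proof (rule AE_I2, rule LIMSEQ_I)
      fix x and d :: real assume x: "x \<in> space M" and "0 < d"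
      have "\<forall>\<^sub>F n in sequentially. u n x < U x + d"
        unfolding U_def by (rule eventually_less_real_limsup[where B = B]) (use u x \<open>0 < d\<close> in auto)
      then show "\<exists>N. \<forall>n\<ge>N. norm (max 0 (u n x - U x) - 0) < d"
        using \<open>0 < d\<close> by (auto simp: eventually_sequentially diff_less_eq add.commute)
    qed
    show "AE x in M. norm (max 0 (u n x - U x)) \<le> B" for n
    proof (rule AE_I2)
      fix x assume "x \<in> space M"
      with U[of x] u[of x n] show "norm (max 0 (u n x - U x)) \<le> B" by auto
    qed
  qed auto
  then have "\<forall>\<^sub>F n in sequentially. (\<integral>x. max 0 (u n x - U x) \<partial>M) < e"
    using \<open>0 < e\<close> by (intro order_tendstoD(2)) auto
  then show ?thesis
  proof eventually_elim
    case (elim n)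
    have "(\<integral>x. u n x \<partial>M) \<le> (\<integral>x. U x + max 0 (u n x - U x) \<partial>M)"
      by (rule integral_mono) (use intU in auto)
    also have "\<dots> = (\<integral>x. U x \<partial>M) + (\<integral>x. max 0 (u n x - U x) \<partial>M)"
      by (rule Bochner_Integration.integral_add) (use intU in auto)
    finally show ?case using elim by (simp add: U_def)
  qed
qed

text \<open>Jensen's inequality through the tangent of the entropy function at the mean.\<close>

lemma integral_neg_mult_log_le:
  fixes f :: "'a \<Rightarrow> real"
  assumes [measurable]: "f \<in> borel_measurable M"
    and f: "AE x in M. 0 \<le> f x" "AE x in M. f x \<le> 1"
  defines "m \<equiv> \<integral>x. f x \<partial>M"
  shows "(\<integral>x. - (f x * log 2 (f x)) \<partial>M) \<le> - (m * log 2 m)"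
proof -
  have int: "integrable M f"
    by (rule integrable_const_bound[where B = 1]) (use f in \<open>auto elim: eventually_elim2\<close>)
  have "0 \<le> m" unfolding m_def by (rule integral_nonneg_AE[OF f(1)])
  show ?thesis
  proof (cases "m = 0")
    \<comment> \<open>At mean 0 the tangent would be vertical, but then \<open>f\<close> vanishes
      almost everywhere.\<close>
    case True
    then have "AE x in M. f x = 0"
      using integral_nonneg_eq_0_iff_AE[OF int f(1)] by (simp add: m_def)
    then have "(\<integral>x. - (f x * log 2 (f x)) \<partial>M) = (\<integral>x. 0 \<partial>M)"
      by (intro integral_cong_AE) (auto elim: eventually_mono)
    then show ?thesis using True by simp
  next
    case False
    with \<open>0 \<le> m\<close> have "0 < m" by simp
    have tangent: "- (t * log 2 t) \<le> (m - t) / ln 2 - t * log 2 m" if "0 \<le> t" for t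
    proof (cases "t = 0")
      case False
      then have "0 < t" using that by simp
      have "ln (m / t) \<le> m / t - 1" using \<open>0 < t\<close> \<open>0 < m\<close> by (intro ln_le_minus_one) simp
      then have "t * (ln m - ln t) \<le> t * (m / t - 1)"
        using \<open>0 < t\<close> \<open>0 < m\<close> by (intro mult_left_mono) (auto simp: ln_div)
      also have "\<dots> = m - t" using \<open>0 < t\<close> by (simp add: right_diff_distrib)
      finally have "t * (ln m - ln t) / ln 2 \<le> (m - t) / ln 2"
        by (rule divide_right_mono) simp
      then show ?thesis by (simp add: log_def right_diff_distrib diff_divide_distrib)
    qed (use \<open>0 < m\<close> in simp)
    have "(\<integral>x. - (f x * log 2 (f x)) \<partial>M) \<le> (\<integral>x. (m - f x) / ln 2 - f x * log 2 m \<partial>M)"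
    \<comment> \<open>This form of monotonicity asks for a nonnegative majorant in place of
      integrability of the left side; the tangent is nonnegative since it lies above the entropy
      function on [0, 1].\<close>
    proof (rule integral_mono_AE')
      show "integrable M (\<lambda>x. (m - f x) / ln 2 - f x * log 2 m)" using int by simp
      show "AE x in M. - (f x * log 2 (f x)) \<le> (m - f x) / ln 2 - f x * log 2 m"
        using f(1) by eventually_elim (rule tangent)
      show "AE x in M. 0 \<le> (m - f x) / ln 2 - f x * log 2 m"
        using f by eventually_elim (rule order_trans[OF neg_mult_log_bounds(1) tangent])
    qed
    also have "\<dots> = (m - m) / ln 2 - m * log 2 m"
      using int by (simp add: Bochner_Integration.integral_diff prob_space m_def)
    finally show ?thesis by simp
  qed
qed

end

text \<open>For p = 0 the logarithm is of no help, but t log t is continuous from the right at 0 and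
  \<open>f\<close> stays nonnegative. This covers blocks whose limiting frequency is 0.\<close>

lemma tendsto_mult_log:
  fixes f :: "nat \<Rightarrow> real"
  assumes f: "f \<longlonglongrightarrow> p" and nonneg: "\<And>n. 0 \<le> f n"
  shows "(\<lambda>n. f n * log 2 (f n)) \<longlonglongrightarrow> p * log 2 p"
proof (cases "p = 0")
  case True
  have "((\<lambda>t::real. t * log 2 t) \<longlongrightarrow> 0) (at_right 0)" by real_asymp
  then have "continuous (at 0 within {0..}) (\<lambda>t::real. t * log 2 t)"
    by (simp add: continuous_within at_within_Ici_at_right)
  then have "((\<lambda>n. f n * log 2 (f n)) \<longlongrightarrow> 0 * log 2 0) sequentially"
    by (rule continuous_within_tendsto_compose'[where S = "{0..}"]) (use f nonneg True in auto)
  then show ?thesis using True by simp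
next
  case False
  then have "0 < p" using LIMSEQ_le_const[OF f, of 0] nonneg by force
  then show ?thesis by (intro tendsto_intros f) auto
qed

section \<open>The pointwise ergodic theorem for bounded functions\<close>

lemma abs_mult_indicator_le:
  fixes a B :: real
  assumes "\<bar>a\<bar> \<le> B"
  shows "\<bar>a * indicator E x\<bar> \<le> B"
  using assms order_trans[OF abs_ge_zero assms] by (cases "x \<in> E") auto

locale measure_preserving_system = prob_space M for M :: "'a measure" +
  fixes T :: "'a \<Rightarrow> 'a"
  assumes T[measurable]: "T \<in> M \<rightarrow>\<^sub>M M" and distr_T: "distr M M T = M"
begin

lemma funpow_measurable[measurable]: "(T ^^ n) \<in> M \<rightarrow>\<^sub>M M"
proof (induction n)
  case (Suc n)
  note Suc[measurable]
  have "(\<lambda>x. T ((T ^^ n) x)) \<in> M \<rightarrow>\<^sub>M M" by measurable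
  then show ?case by (simp add: comp_def)
qed (simp add: id_def)

lemma integral_comp_T:
  fixes f :: "'a \<Rightarrow> real"
  assumes "f \<in> borel_measurable M"
  shows "(\<integral>x. f (T x) \<partial>M) = (\<integral>x. f x \<partial>M)"
  using integral_distr[OF T assms] by (simp add: distr_T)

lemma integral_comp_funpow:
  fixes f :: "'a \<Rightarrow> real"
  assumes [measurable]: "f \<in> borel_measurable M"
  shows "(\<integral>x. f ((T ^^ n) x) \<partial>M) = (\<integral>x. f x \<partial>M)"
proof (induction n)
  case (Suc n)
  have "(\<integral>x. f ((T ^^ n) (T x)) \<partial>M) = (\<integral>x. f ((T ^^ n) x) \<partial>M)"
    by (rule integral_comp_T) measurable
  with Suc show ?case by (simp add: funpow_swap1)
qed simp

section \<open>Birkhoff sums and the maximal ergodic inequality\<close>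

definition birkhoff_sum :: "('a \<Rightarrow> real) \<Rightarrow> nat \<Rightarrow> 'a \<Rightarrow> real" where
  "birkhoff_sum f n x = (\<Sum>k<n. f ((T ^^ k) x))"

lemma birkhoff_sum_measurable[measurable (raw)]:
  assumes [measurable]: "f \<in> borel_measurable M"
  shows "birkhoff_sum f n \<in> borel_measurable M"
  unfolding birkhoff_sum_def[abs_def] by measurable

lemma birkhoff_sum_0[simp]: "birkhoff_sum f 0 x = 0"
  by (simp add: birkhoff_sum_def)

lemma birkhoff_sum_Suc: "birkhoff_sum f (Suc n) x = f x + birkhoff_sum f n (T x)"
  unfolding birkhoff_sum_def sum.lessThan_Suc_shift by (simp add: funpow_swap1)

lemma birkhoff_sum_T: "birkhoff_sum f n (T x) = birkhoff_sum f n x + f ((T ^^ n) x) - f x"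
  using birkhoff_sum_Suc[of f n x] by (simp add: birkhoff_sum_def)

lemma abs_birkhoff_sum_le:
  assumes "\<And>x. \<bar>f x\<bar> \<le> B"
  shows "\<bar>birkhoff_sum f n x\<bar> \<le> real n * B"
proof -
  have "\<bar>birkhoff_sum f n x\<bar> \<le> (\<Sum>k<n. \<bar>f ((T ^^ k) x)\<bar>)"
    unfolding birkhoff_sum_def by (rule sum_abs)
  also have "\<dots> \<le> (\<Sum>k<n. B)" using assms by (intro sum_mono)
  finally show ?thesis by simp
qed

lemma integral_birkhoff_sum:
  assumes [measurable]: "f \<in> borel_measurable M" and B: "\<And>x. \<bar>f x\<bar> \<le> B"
  shows "(\<integral>x. birkhoff_sum f n x \<partial>M) = real n * (\<integral>x. f x \<partial>M)"
proof -
  have [measurable]: "(\<lambda>x. f ((T ^^ k) x)) \<in> borel_measurable M" for k by measurable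
  have "integrable M (\<lambda>x. f ((T ^^ k) x))" for k
    by (rule integrable_const_bound[where B = B]) (use B in auto)
  then show ?thesis
    unfolding birkhoff_sum_def by (simp add: Bochner_Integration.integral_sum integral_comp_funpow)
qed

text \<open>The maximum of the Birkhoff sums up to time n and 0; the recursion is what makes
  Garsia's proof of the maximal ergodic inequality work.\<close>

fun max_sum :: "('a \<Rightarrow> real) \<Rightarrow> nat \<Rightarrow> 'a \<Rightarrow> real" where
  "max_sum f 0 x = 0"
| "max_sum f (Suc n) x = max 0 (f x + max_sum f n (T x))"

lemma max_sum_measurable[measurable (raw)]:
  assumes [measurable]: "f \<in> borel_measurable M"
  shows "max_sum f n \<in> borel_measurable M"
proof (induction n)
  case (Suc n)
  note Suc[measurable]
  show ?case unfolding max_sum.simps[abs_def] by measurable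
qed simp

lemma max_sum_nonneg: "0 \<le> max_sum f n x"
  by (cases n) auto

lemma max_sum_le_Suc: "max_sum f n x \<le> max_sum f (Suc n) x"
proof (induction n arbitrary: x)
  case (Suc n)
  from Suc[of "T x"] show ?case by auto
qed simp

lemma max_sum_mono: "m \<le> n \<Longrightarrow> max_sum f m x \<le> max_sum f n x"
  by (rule lift_Suc_mono_le[of "\<lambda>n. max_sum f n x"]) (auto simp del: max_sum.simps intro: max_sum_le_Suc)

lemma birkhoff_sum_le_max_sum: "birkhoff_sum f n x \<le> max_sum f n x"
proof (induction n arbitrary: x)
  case (Suc n)
  from Suc[of "T x"] show ?case by (simp add: birkhoff_sum_Suc)
qed simp

lemma max_sum_attained: "\<exists>k\<le>n. max_sum f n x = birkhoff_sum f k x"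
proof (induction n arbitrary: x)
  case (Suc n)
  from Suc[of "T x"] obtain k where "k \<le> n" "max_sum f n (T x) = birkhoff_sum f k (T x)" by blast
  then have "max_sum f (Suc n) x = birkhoff_sum f (if max_sum f (Suc n) x = 0 then 0 else Suc k) x"
    by (auto simp: birkhoff_sum_Suc max_def)
  with \<open>k \<le> n\<close> show ?case by (intro exI[of _ "if max_sum f (Suc n) x = 0 then 0 else Suc k"]) auto
qed simp

lemma max_sum_bound:
  assumes "\<And>x. \<bar>f x\<bar> \<le> B"
  shows "\<bar>max_sum f n x\<bar> \<le> real n * B"
proof -
  have "0 \<le> B" using assms[of undefined] by linarith
  obtain k where "k \<le> n" "max_sum f n x = birkhoff_sum f k x" using max_sum_attained by blast
  with abs_birkhoff_sum_le[of f B k x, OF assms] have "\<bar>max_sum f n x\<bar> \<le> real k * B" by simp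
  also have "\<dots> \<le> real n * B" using \<open>k \<le> n\<close> \<open>0 \<le> B\<close> by (intro mult_right_mono) auto
  finally show ?thesis .
qed

text \<open>Let M_n be the maximum. Where M_n > 0, the recursion and monotonicity in n give M_n
  \<le> f + M_n o T; elsewhere M_n = 0 \<le> M_n o T. So M_n - M_n o T, whose integral is 0 by
  invariance, lies below f times the indicator.\<close>

lemma maximal_ergodic_step:
  assumes f[measurable]: "f \<in> borel_measurable M" and B: "\<And>x. \<bar>f x\<bar> \<le> B"
  shows "0 \<le> (\<integral>x. f x * indicator {x\<in>space M. 0 < max_sum f n x} x \<partial>M)"
proof (cases n)
  case (Suc m)
  define E where "E = {x\<in>space M. 0 < max_sum f n x}"
  have [measurable]: "E \<in> sets M" unfolding E_def by measurable
  have [measurable]: "(\<lambda>x. max_sum f n (T x)) \<in> borel_measurable M"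
    by (rule measurable_compose[OF T max_sum_measurable[OF f]])
  have int: "integrable M (max_sum f n)" "integrable M (\<lambda>x. max_sum f n (T x))"
    by (rule integrable_const_bound[where B = "real n * B"];
        use max_sum_bound[of f B n, OF B] in auto)+
  have intE: "integrable M (\<lambda>x. f x * indicator E x)"
    by (rule integrable_const_bound[where B = B])
      (use B in \<open>auto intro: abs_mult_indicator_le\<close>)
  have "0 = (\<integral>x. max_sum f n x - max_sum f n (T x) \<partial>M)"
    by (simp add: Bochner_Integration.integral_diff int integral_comp_T)
  also have "\<dots> \<le> (\<integral>x. f x * indicator E x \<partial>M)"
  proof (rule integral_mono)
    fix x assume x: "x \<in> space M"
    show "max_sum f n x - max_sum f n (T x) \<le> f x * indicator E x"
    proof (cases "x \<in> E")
      case True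
      then have "max_sum f n x = f x + max_sum f m (T x)" by (auto simp: E_def Suc max_def split: if_splits)
      also have "\<dots> \<le> f x + max_sum f n (T x)" using max_sum_le_Suc Suc by simp
      finally show ?thesis using True by simp
    next
      case False
      then have "max_sum f n x = 0" using x max_sum_nonneg[of f n x] by (auto simp: E_def)
      then show ?thesis using False max_sum_nonneg[of f n "T x"] by simp
    qed
  qed (use int intE in auto)
  finally show ?thesis unfolding E_def .
qed simp

text \<open>As n grows, the sets where the maximum is positive increase to the set where some
  Birkhoff sum is positive.\<close>

lemma maximal_ergodic:
  assumes f[measurable]: "f \<in> borel_measurable M" and B: "\<And>x. \<bar>f x\<bar> \<le> B"
  shows "0 \<le> (\<integral>x. f x * indicator {x\<in>space M. \<exists>n. 0 < birkhoff_sum f n x} x \<partial>M)"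
proof -
  define E where "E n = {x\<in>space M. 0 < max_sum f n x}" for n
  have [measurable]: "E n \<in> sets M" for n unfolding E_def by measurable
  have E: "(\<Union>n. E n) = {x\<in>space M. \<exists>n. 0 < birkhoff_sum f n x}"
    using max_sum_attained[of _ f] birkhoff_sum_le_max_sum[of f]
    by (auto simp: E_def) (metis, metis less_le_trans)
  have "incseq E"
    using max_sum_mono[of _ _ f] by (auto simp: incseq_def E_def intro: less_le_trans)
  have "(\<lambda>n. \<integral>x. f x * indicator (E n) x \<partial>M) \<longlonglongrightarrow> (\<integral>x. f x * indicator (\<Union>n. E n) x \<partial>M)"
  proof (rule integral_dominated_convergence[where w = "\<lambda>_. B"])
    show "AE x in M. (\<lambda>n. f x * indicator (E n) x) \<longlonglongrightarrow> f x * indicator (\<Union>n. E n) x"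
      by (intro AE_I2 tendsto_mult tendsto_const LIMSEQ_indicator_incseq \<open>incseq E\<close>)
    show "AE x in M. norm (f x * indicator (E n) x) \<le> B" for n
      using B by (intro AE_I2) (auto intro: abs_mult_indicator_le)
  qed auto
  moreover have "0 \<le> (\<integral>x. f x * indicator (E n) x \<partial>M)" for n
    unfolding E_def using maximal_ergodic_step[OF f B] .
  ultimately show ?thesis unfolding E by (intro LIMSEQ_le_const) auto
qed

text \<open>Apply the maximal inequality to f - c cut off outside \<open>D\<close>. An orbit never
  crosses the boundary of an invariant set, so on \<open>D\<close> the Birkhoff sums are those of f
  - c and off \<open>D\<close> they vanish; the set of positivity is then \<open>D\<close>
  itself.\<close>

lemma maximal_ergodic_invariant:
  assumes f[measurable]: "f \<in> borel_measurable M" and B: "\<And>x. \<bar>f x\<bar> \<le> B"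
    and D[measurable]: "D \<in> sets M" and inv: "\<And>x. x \<in> space M \<Longrightarrow> T x \<in> D \<longleftrightarrow> x \<in> D"
    and pos: "\<And>x. x \<in> D \<Longrightarrow> \<exists>n. real n * c < birkhoff_sum f n x"
  shows "c * measure M D \<le> (\<integral>x. f x * indicator D x \<partial>M)"
proof -
  define g where "g x = (f x - c) * indicator D x" for x
  have [measurable]: "g \<in> borel_measurable M" unfolding g_def by measurable
  have sub: "D \<subseteq> space M" using sets.sets_into_space[OF D] .
  have sum: "birkhoff_sum g n x = indicator D x * (birkhoff_sum f n x - real n * c)"
    if "x \<in> space M" for n x
    using that
  proof (induction n arbitrary: x)
    case (Suc n)
    then have "T x \<in> space M" using measurable_space[OF T] by blast
    from Suc.IH[OF this] show ?case using inv[OF Suc.prems]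
      by (auto simp: birkhoff_sum_Suc g_def indicator_def algebra_simps)
  qed simp
  have gB: "\<bar>g x\<bar> \<le> B + \<bar>c\<bar>" for x
    using B[of x] abs_triangle_ineq4[of "f x" c]
    by (auto simp: g_def indicator_def)
  have "{x\<in>space M. \<exists>n. 0 < birkhoff_sum g n x} = D"
    using sub pos by (auto simp: sum indicator_def of_bool_def split: if_splits)
  with maximal_ergodic[of g, OF _ gB] have "0 \<le> (\<integral>x. g x * indicator D x \<partial>M)" by simp
  also have "\<dots> = (\<integral>x. f x * indicator D x - c * indicator D x \<partial>M)"
    by (rule Bochner_Integration.integral_cong) (auto simp: g_def indicator_def)
  also have "\<dots> = (\<integral>x. f x * indicator D x \<partial>M) - c * measure M D"
  proof (subst Bochner_Integration.integral_diff)
    show "integrable M (\<lambda>x. f x * indicator D x)"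
      by (rule integrable_const_bound[where B = B])
        (use B in \<open>auto intro: abs_mult_indicator_le\<close>)
      have "integrable M (indicator D :: 'a \<Rightarrow> real)"
      by (rule integrable_const_bound[where B = 1]) auto
    then show "integrable M (\<lambda>x. c * indicator D x)" by simp
  qed (use sub in \<open>auto simp: Int_absorb2\<close>)
  finally show ?thesis by simp
qed

section \<open>Almost sure convergence of Birkhoff averages\<close>

definition birkhoff_avg :: "('a \<Rightarrow> real) \<Rightarrow> nat \<Rightarrow> 'a \<Rightarrow> real" where
  "birkhoff_avg f n x = birkhoff_sum f n x / real n"

lemma birkhoff_avg_measurable[measurable (raw)]:
  "f \<in> borel_measurable M \<Longrightarrow> birkhoff_avg f n \<in> borel_measurable M"
  unfolding birkhoff_avg_def[abs_def] by (intro borel_measurable_divide birkhoff_sum_measurable) auto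

lemma abs_birkhoff_avg_le:
  assumes "\<And>x. \<bar>f x\<bar> \<le> B"
  shows "\<bar>birkhoff_avg f n x\<bar> \<le> B"
  using abs_birkhoff_sum_le[of f B n x, OF assms] assms[of x]
  by (cases "n = 0") (auto simp: birkhoff_avg_def field_simps)

lemma birkhoff_avg_T_diff:
  assumes B: "\<And>x. \<bar>f x\<bar> \<le> B"
  shows "(\<lambda>n. birkhoff_avg f n (T x) - birkhoff_avg f n x) \<longlonglongrightarrow> 0"
proof (rule Lim_null_comparison)
  show "\<forall>\<^sub>F n in sequentially. norm (birkhoff_avg f n (T x) - birkhoff_avg f n x) \<le> (2 * B) / real n"
  proof (rule always_eventually, rule allI)
    fix n
    have "\<bar>f ((T ^^ n) x) - f x\<bar> \<le> 2 * B" using B[of "(T ^^ n) x"] B[of x] by linarith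
    then show "norm (birkhoff_avg f n (T x) - birkhoff_avg f n x) \<le> (2 * B) / real n"
      by (simp add: birkhoff_avg_def birkhoff_sum_T divide_right_mono flip: diff_divide_distrib)
  qed
qed (rule lim_const_over_n)

lemma limsup_birkhoff_avg_T:
  assumes B: "\<And>x. \<bar>f x\<bar> \<le> B"
  shows "limsup (\<lambda>n. ereal (birkhoff_avg f n (T x))) = limsup (\<lambda>n. ereal (birkhoff_avg f n x))"
    and "liminf (\<lambda>n. ereal (birkhoff_avg f n (T x))) = liminf (\<lambda>n. ereal (birkhoff_avg f n x))"
proof -
  define d where "d n = ereal (birkhoff_avg f n (T x) - birkhoff_avg f n x)" for n
  have d: "d \<longlonglongrightarrow> 0" using birkhoff_avg_T_diff[of f B x, OF B] by (simp add: d_def[abs_def] zero_ereal_def)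
  have eq: "(\<lambda>n. ereal (birkhoff_avg f n (T x))) = (\<lambda>n. d n + ereal (birkhoff_avg f n x))"
    by (simp add: d_def)
  show "limsup (\<lambda>n. ereal (birkhoff_avg f n (T x))) = limsup (\<lambda>n. ereal (birkhoff_avg f n x))"
    unfolding eq by (subst ereal_limsup_lim_add[OF d]) auto
  show "liminf (\<lambda>n. ereal (birkhoff_avg f n (T x))) = liminf (\<lambda>n. ereal (birkhoff_avg f n x))"
    unfolding eq by (subst ereal_liminf_lim_add[OF d]) auto
qed

text \<open>Upper and lower limits of the averages are invariant at every point, so the gap set
  \<open>D\<close> is invariant. The previous lemma for f with level b and for -f with level -a
  squeezes the integral of f over \<open>D\<close> between b times and a times the measure of
  \<open>D\<close>, which must be 0.\<close>

lemma birkhoff_gap_null: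
  assumes f[measurable]: "f \<in> borel_measurable M" and B: "\<And>x. \<bar>f x\<bar> \<le> B" and "a < b"
  shows "AE x in M. \<not> (liminf (\<lambda>n. ereal (birkhoff_avg f n x)) < ereal a \<and>
      ereal b < limsup (\<lambda>n. ereal (birkhoff_avg f n x)))"
proof -
  define D where "D = {x\<in>space M. liminf (\<lambda>n. ereal (birkhoff_avg f n x)) < ereal a \<and>
      ereal b < limsup (\<lambda>n. ereal (birkhoff_avg f n x))}"
  have D[measurable]: "D \<in> sets M" unfolding D_def by measurable
  have inv: "T x \<in> D \<longleftrightarrow> x \<in> D" if "x \<in> space M" for x
    using that measurable_space[OF T that] by (simp add: D_def limsup_birkhoff_avg_T[of f B, OF B])
  have "\<exists>n. real n * b < birkhoff_sum f n x" if "x \<in> D" for x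
  proof (rule ccontr)
    assume *: "\<not> ?thesis"
    have "limsup (\<lambda>n. ereal (birkhoff_avg f n x)) \<le> ereal b"
    proof (rule Limsup_bounded, rule eventually_sequentiallyI[of 1])
      fix n :: nat assume "1 \<le> n"
      then show "ereal (birkhoff_avg f n x) \<le> ereal b"
        using * by (auto simp: birkhoff_avg_def field_simps not_less)
    qed
    with that show False by (auto simp: D_def)
  qed
  from maximal_ergodic_invariant[OF f B D inv this]
  have up: "b * measure M D \<le> (\<integral>x. f x * indicator D x \<partial>M)" by blast
  have "\<exists>n. real n * (- a) < birkhoff_sum (\<lambda>x. - f x) n x" if "x \<in> D" for x
  proof (rule ccontr)
    assume *: "\<not> ?thesis"
    have "ereal a \<le> liminf (\<lambda>n. ereal (birkhoff_avg f n x))"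
    proof (rule Liminf_bounded, rule eventually_sequentiallyI[of 1])
      fix n :: nat assume "1 \<le> n"
      then show "ereal a \<le> ereal (birkhoff_avg f n x)"
        using * by (auto simp: birkhoff_avg_def birkhoff_sum_def sum_negf field_simps not_less)
    qed
    with that show False by (auto simp: D_def)
  qed
  from maximal_ergodic_invariant[of "\<lambda>x. - f x" B, OF _ _ D inv this]
  have lo: "(\<integral>x. f x * indicator D x \<partial>M) \<le> a * measure M D" using B by auto
  have "(b - a) * measure M D \<le> 0" using up lo by (simp add: algebra_simps)
  then have "measure M D = 0"
    using \<open>a < b\<close> measure_nonneg[of M D] by (auto simp: mult_le_0_iff)
  then have "AE x in M. x \<notin> D"
    by (intro AE_not_in) (auto simp: null_sets_def emeasure_eq_measure)
  then show ?thesis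
    by (rule AE_mp) (rule AE_I2, auto simp: D_def)
qed

text \<open>A bounded divergent sequence leaves a gap between two rationals, and there are countably
  many such pairs. Only existence of the limit is established here; its invariance and its integral
  are later read off the averages.\<close>

theorem birkhoff_convergent:
  assumes f[measurable]: "f \<in> borel_measurable M" and B: "\<And>x. \<bar>f x\<bar> \<le> B"
  shows "AE x in M. convergent (\<lambda>n. birkhoff_avg f n x)"
proof -
  have "AE x in M. \<forall>(a, b)\<in>{(a, b). a \<in> \<rat> \<and> b \<in> \<rat> \<and> a < b}.
      \<not> (liminf (\<lambda>n. ereal (birkhoff_avg f n x)) < ereal a \<and>
      ereal b < limsup (\<lambda>n. ereal (birkhoff_avg f n x)))"
  proof (subst AE_ball_countable)
    have "countable (\<rat> \<times> \<rat> :: (real \<times> real) set)" using countable_rat by blast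
    then show "countable {(a, b). a \<in> \<rat> \<and> b \<in> \<rat> \<and> a < (b::real)}"
      by (rule countable_subset[rotated]) auto
  qed (use birkhoff_gap_null[OF f B] in auto)
  then show ?thesis
  proof eventually_elim
    case (elim x)
    define u where "u n = ereal (birkhoff_avg f n x)" for n
    have le: "liminf u \<le> limsup u" by (rule Liminf_le_Limsup) simp
    have up: "limsup u \<le> ereal B"
    proof (rule Limsup_bounded, rule always_eventually, rule allI)
      fix n show "u n \<le> ereal B"
        using abs_birkhoff_avg_le[of f B n x, OF B] by (auto simp: u_def)
    qed
    have lo: "ereal (- B) \<le> liminf u"
    proof (rule Liminf_bounded, rule always_eventually, rule allI)
      fix n show "ereal (- B) \<le> u n"
        using abs_birkhoff_avg_le[of f B n x, OF B] by (auto simp: u_def)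
    qed
    obtain s where s: "limsup u = ereal s"
      using order_trans[OF lo le] up by (cases "limsup u") auto
    obtain i where i: "liminf u = ereal i"
      using lo order_trans[OF le up] by (cases "liminf u") auto
    have "i = s"
    proof (rule ccontr)
      assume "i \<noteq> s"
      with le have "i < s" by (simp add: s i)
      then obtain b where b: "b \<in> \<rat>" "i < b" "b < s" using Rats_dense_in_real by blast
      then obtain a where "a \<in> \<rat>" "i < a" "a < b" using Rats_dense_in_real by blast
      with b elim show False by (auto simp: s[unfolded u_def] i[unfolded u_def])
    qed
    then have "u \<longlonglongrightarrow> ereal s" by (simp add: tendsto_iff_Liminf_eq_Limsup s i)
    then have "(\<lambda>n. birkhoff_avg f n x) \<longlonglongrightarrow> s" by (simp add: u_def[abs_def])
    then show ?case by (rule convergentI)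
  qed
qed

end

section \<open>Block frequencies of itineraries\<close>

definition words :: "nat \<Rightarrow> nat \<Rightarrow> nat list set" where
  "words r l = {w. length w = l \<and> set w \<subseteq> {1..r}}"

lemma finite_words[simp]: "finite (words r l)"
proof -
  have "words r l = {w. set w \<subseteq> {1..r} \<and> length w = l}" by (auto simp: words_def)
  then show ?thesis by (simp add: finite_lists_length_eq)
qed

lemma bij_betw_append_words:
  "bij_betw (\<lambda>(u, v). u @ v) (words r l \<times> words r m) (words r (l + m))"
proof (rule bij_betw_byWitness[where f' = "\<lambda>w. (take l w, drop l w)"])
  show "(\<lambda>w. (take l w, drop l w)) ` words r (l + m) \<subseteq> words r l \<times> words r m"
    by (auto simp: words_def dest: in_set_takeD in_set_dropD)
qed (auto simp: words_def subset_iff)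

lemma emp_freq_bounds: "0 \<le> emp_freq s w" "emp_freq s w \<le> 1"
proof -
  have "card {i. i \<le> length s - length w \<and> take (length w) (drop i s) = w}
      \<le> card {..length s - length w}"
    by (rule card_mono) auto
  then have "card {i. i \<le> length s - length w \<and> take (length w) (drop i s) = w}
      \<le> length s - length w + 1"
    by simp
  from of_nat_mono[OF this, where 'a = real] show "emp_freq s w \<le> 1"
    unfolding emp_freq_def by (simp add: divide_le_eq)
qed (simp add: emp_freq_def)

lemma emp_freq_eq_0:
  assumes "\<not> set w \<subseteq> set s"
  shows "emp_freq s w = 0"
proof -
  have "take (length w) (drop i s) \<noteq> w" for i
    using assms by (metis in_set_dropD in_set_takeD subsetI)
  then show ?thesis by (simp add: emp_freq_def)
qed

text \<open>\<open>emp_entropy\<close> ranges over words in the letters of \<open>s\<close>, an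
  index set that changes with \<open>s\<close>. Over the fixed finite set \<open>words r l\<close>
  the extra terms vanish, and limits can be taken term by term.\<close>

lemma emp_entropy_eq_sum_words:
  assumes "set s \<subseteq> {1..r}"
  shows "emp_entropy l s = (\<Sum>w\<in>words r l. - (emp_freq s w * log 2 (emp_freq s w))) / real l"
proof -
  have "(\<Sum>w | length w = l \<and> set w \<subseteq> set s. emp_freq s w * log 2 (emp_freq s w)) =
      (\<Sum>w\<in>words r l. emp_freq s w * log 2 (emp_freq s w))"
  proof (rule sum.mono_neutral_left)
    show "{w. length w = l \<and> set w \<subseteq> set s} \<subseteq> words r l" using assms by (auto simp: words_def)
    show "\<forall>w\<in>words r l - {w. length w = l \<and> set w \<subseteq> set s}.
        emp_freq s w * log 2 (emp_freq s w) = 0"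
      using emp_freq_eq_0 by (auto simp: words_def)
  qed simp
  then show ?thesis by (simp add: emp_entropy_def sum_negf)
qed

lemma emp_entropy_bounds:
  assumes "set s \<subseteq> {1..r}"
  shows "0 \<le> emp_entropy l s" "emp_entropy l s \<le> real (card (words r l)) / ln 2"
proof -
  let ?S = "\<Sum>w\<in>words r l. - (emp_freq s w * log 2 (emp_freq s w))"
  have S: "0 \<le> ?S" by (intro sum_nonneg neg_mult_log_bounds emp_freq_bounds)
  then show "0 \<le> emp_entropy l s" using emp_entropy_eq_sum_words[OF assms] by simp
  have "emp_entropy l s \<le> ?S"
    unfolding emp_entropy_eq_sum_words[OF assms]
    using S by (cases "l = 0") (auto simp: divide_le_eq intro: mult_left_mono[of 1 "real l" ?S, simplified])
  also have "\<dots> \<le> (\<Sum>w\<in>words r l. 1 / ln 2)"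
    by (intro sum_mono neg_mult_log_bounds emp_freq_bounds)
  finally show "emp_entropy l s \<le> real (card (words r l)) / ln 2" by simp
qed

context measure_preserving_system begin

lemma funpow_space: "x \<in> space M \<Longrightarrow> (T ^^ n) x \<in> space M"
  using measurable_space[OF funpow_measurable] .

lemma birkhoff_avg_cong:
  assumes "x \<in> space M" "\<And>y. y \<in> space M \<Longrightarrow> f y = g y"
  shows "birkhoff_avg f n x = birkhoff_avg g n x"
  unfolding birkhoff_avg_def birkhoff_sum_def using assms funpow_space by simp

lemma birkhoff_avg_sum: "birkhoff_avg (\<lambda>y. \<Sum>i\<in>I. f i y) n x = (\<Sum>i\<in>I. birkhoff_avg (f i) n x)"
  unfolding birkhoff_avg_def birkhoff_sum_def
  by (subst sum.swap) (simp add: sum_divide_distrib)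

lemma birkhoff_avg_comp_funpow:
  "birkhoff_avg (\<lambda>y. f ((T ^^ l) y)) n x = birkhoff_avg f n ((T ^^ l) x)"
proof -
  have "(T ^^ l) ((T ^^ k) x) = (T ^^ k) ((T ^^ l) x)" for k
    by (metis add.commute comp_apply funpow_add)
  then show ?thesis by (simp add: birkhoff_avg_def birkhoff_sum_def)
qed

lemma birkhoff_avg_funpow_tendsto:
  assumes B: "\<And>x. \<bar>f x\<bar> \<le> B" and "(\<lambda>n. birkhoff_avg f n x) \<longlonglongrightarrow> L"
  shows "(\<lambda>n. birkhoff_avg f n ((T ^^ l) x)) \<longlonglongrightarrow> L"
proof (induction l)
  case (Suc l)
  from tendsto_add[OF this birkhoff_avg_T_diff[of f B "(T ^^ l) x", OF B]]
  show ?case by simp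
qed (use assms in simp)

end

section \<open>Itineraries and cylinders of a partition\<close>

locale symbolic_system = measure_preserving_system +
  fixes r :: nat and A :: "nat \<Rightarrow> 'a set"
  assumes partition: "meas_partition M r A"
begin

lemma ex1_symb: "x \<in> space M \<Longrightarrow> \<exists>!i. i \<in> {1..r} \<and> x \<in> A i"
  using partition unfolding meas_partition_def by blast

lemma symb_in: "x \<in> space M \<Longrightarrow> symb r A x \<in> {1..r} \<and> x \<in> A (symb r A x)"
  unfolding symb_def using theI'[OF ex1_symb] .

lemma symb_eq_iff: "x \<in> space M \<Longrightarrow> i \<in> {1..r} \<Longrightarrow> symb r A x = i \<longleftrightarrow> x \<in> A i"
  using symb_in ex1_symb by blast

lemma symb_measurable[measurable]: "symb r A \<in> M \<rightarrow>\<^sub>M count_space UNIV"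
proof (subst measurable_count_space_eq2_countable, safe)
  fix i :: nat
  have A: "A i \<in> sets M" if "i \<in> {1..r}" using that partition by (auto simp: meas_partition_def)
  have "symb r A -` {i} \<inter> space M = (if i \<in> {1..r} then A i else {})"
    using symb_in symb_eq_iff A sets.sets_into_space by (auto split: if_splits) blast+
  then show "symb r A -` {i} \<inter> space M \<in> sets M" using A by auto
qed auto

abbreviation itinerary :: "'a \<Rightarrow> nat \<Rightarrow> nat list" where
  "itinerary \<equiv> itin T r A"

lemma length_itin[simp]: "length (itinerary x n) = n"
  by (simp add: itin_def)

lemma set_itin: "x \<in> space M \<Longrightarrow> set (itinerary x n) \<subseteq> {1..r}"
  using symb_in[OF funpow_space] by (auto simp: itin_def)

lemma itin_in_words: "x \<in> space M \<Longrightarrow> itinerary x n \<in> words r n"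
  using set_itin by (simp add: words_def)

lemma itin_add: "itinerary x (l + m) = itinerary x l @ itinerary ((T ^^ l) x) m"
proof (rule nth_equalityI)
  fix i assume "i < length (itinerary x (l + m))"
  moreover have "(T ^^ i) x = (T ^^ (i - l)) ((T ^^ l) x)" if "l \<le> i"
    using that by (metis comp_apply funpow_add le_add_diff_inverse2)
  ultimately show "itinerary x (l + m) ! i = (itinerary x l @ itinerary ((T ^^ l) x) m) ! i"
    by (auto simp: itin_def nth_append)
qed simp

lemma take_drop_itin:
  assumes "i + l \<le> n"
  shows "take l (drop i (itinerary x n)) = itinerary ((T ^^ i) x) l"
proof -
  obtain m where n: "n = i + (l + m)" using assms unfolding le_iff_add by (auto simp: add.assoc)
  have "itinerary x n = itinerary x i @ itinerary ((T ^^ i) x) l @ itinerary ((T ^^ l) ((T ^^ i) x)) m"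
    unfolding n itin_add[of x i] itin_add[of "(T ^^ i) x" l] by (rule refl)
  then show ?thesis by simp
qed

lemma itin_eq_iff: "itinerary x (length w) = w \<longleftrightarrow> (\<forall>j<length w. symb r A ((T ^^ j) x) = w ! j)"
  unfolding list_eq_iff_nth_eq[of "itinerary x (length w)"] by (simp add: itin_def)

text \<open>Defined on the whole type instead of as the indicator of a subset of
  \<open>space M\<close>, so that the bound by 1 and the product rule \<open>cyl_append\<close> hold
  at every point.\<close>

definition cyl :: "nat list \<Rightarrow> 'a \<Rightarrow> real" where
  "cyl w x = of_bool (itinerary x (length w) = w)"

lemma cylinder_sets: "{x\<in>space M. itinerary x (length w) = w} \<in> sets M"
  unfolding itin_eq_iff by measurable

lemma cyl_measurable[measurable]: "cyl w \<in> borel_measurable M"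
proof -
  have "(\<lambda>x. indicator {x\<in>space M. itinerary x (length w) = w} x :: real) \<in> borel_measurable M"
    using cylinder_sets by (rule borel_measurable_indicator)
  then show ?thesis by (rule measurable_cong[THEN iffD1, rotated]) (auto simp: cyl_def)
qed

lemma itin_measurable[measurable]: "(\<lambda>x. itinerary x n) \<in> M \<rightarrow>\<^sub>M count_space UNIV"
proof (subst measurable_count_space_eq2_countable, safe)
  fix w
  show "(\<lambda>x. itinerary x n) -` {w} \<inter> space M \<in> sets M"
  proof (cases "n = length w")
    case True
    have "(\<lambda>x. itinerary x n) -` {w} \<inter> space M = {x\<in>space M. itinerary x (length w) = w}"
      using True by auto
    then show ?thesis using cylinder_sets by simp
  next
    case False
    then have "(\<lambda>x. itinerary x n) -` {w} \<inter> space M = {}" by auto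
    then show ?thesis by simp
  qed
qed auto

lemma itin_fun_measurable[measurable]:
  fixes f :: "nat list \<Rightarrow> real"
  shows "(\<lambda>x. f (itinerary x n)) \<in> borel_measurable M"
  by (rule measurable_compose[OF itin_measurable]) simp

lemma cyl_bound: "\<bar>cyl w x\<bar> \<le> 1"
  by (simp add: cyl_def)

lemma cyl_append: "cyl (u @ v) x = cyl u x * cyl v ((T ^^ length u) x)"
  by (auto simp: cyl_def itin_add)

lemma sum_cyl: "x \<in> space M \<Longrightarrow> (\<Sum>w\<in>words r n. f w * cyl w x) = f (itinerary x n)"
proof -
  assume x: "x \<in> space M"
  have "(\<Sum>w\<in>words r n. f w * cyl w x) = (\<Sum>w\<in>words r n. if w = itinerary x n then f w else 0)"
    by (intro sum.cong) (auto simp: cyl_def words_def)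
  then show ?thesis using itin_in_words[OF x] by simp
qed

lemma integral_cyl: "(\<integral>x. cyl w x \<partial>M) = measure M {x\<in>space M. itinerary x (length w) = w}"
proof -
  have "(\<integral>x. cyl w x \<partial>M) = (\<integral>x. indicator {x\<in>space M. itinerary x (length w) = w} x \<partial>M)"
    by (rule Bochner_Integration.integral_cong) (auto simp: cyl_def)
  then show ?thesis using cylinder_sets by simp
qed

definition cyl_prob :: "nat list \<Rightarrow> real" where
  "cyl_prob w = (\<integral>x. cyl w x \<partial>M)"

lemma integrable_cyl: "integrable M (cyl w)"
  by (rule integrable_const_bound[where B = 1]) (auto simp: cyl_bound)

lemma cyl_prob_nonneg: "0 \<le> cyl_prob w"
  unfolding cyl_prob_def by (simp add: cyl_def)

lemma join_entropy_eq: "join_entropy M T r A n = (\<Sum>w\<in>words r n. - (cyl_prob w * log 2 (cyl_prob w)))"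
  unfolding join_entropy_def sum_negf words_def[symmetric]
  by (intro arg_cong[where f = uminus] sum.cong) (auto simp: cyl_prob_def integral_cyl words_def)

lemma sum_cyl_prob: "(\<Sum>w\<in>words r n. f w * cyl_prob w) = (\<integral>x. f (itinerary x n) \<partial>M)"
proof -
  have "(\<integral>x. f (itinerary x n) \<partial>M) = (\<integral>x. (\<Sum>w\<in>words r n. f w * cyl w x) \<partial>M)"
    by (rule Bochner_Integration.integral_cong) (auto simp: sum_cyl)
  also have "\<dots> = (\<Sum>w\<in>words r n. f w * cyl_prob w)"
    unfolding cyl_prob_def by (subst Bochner_Integration.integral_sum) (auto intro: integrable_cyl)
  finally show ?thesis by simp
qed

text \<open>The window of the itinerary of x at position i is the itinerary of
  \<open>(T ^^ i) x\<close>. The hypothesis keeps the truncated subtraction exact.\<close>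

lemma emp_freq_itin:
  assumes "length w \<le> n"
  shows "emp_freq (itinerary x n) w = birkhoff_avg (cyl w) (n - length w + 1) x"
proof -
  have "{i. i \<le> n - length w \<and> take (length w) (drop i (itinerary x n)) = w} =
      {..<n - length w + 1} \<inter> {i. itinerary ((T ^^ i) x) (length w) = w}"
    using assms take_drop_itin[of _ "length w" n x] by (auto simp: less_Suc_eq_le)
  then show ?thesis
    by (simp add: emp_freq_def birkhoff_avg_def birkhoff_sum_def cyl_def sum_of_bool_eq del: sum.lessThan_Suc)
qed

section \<open>Limiting block frequencies at a generic point\<close>

definition freq :: "nat list \<Rightarrow> 'a \<Rightarrow> real" where
  "freq w x = lim (\<lambda>n. birkhoff_avg (cyl w) n x)"

text \<open>There are countably many words, so one null set serves all blocks of all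
  lengths.\<close>

definition generic :: "'a \<Rightarrow> bool" where
  "generic x \<longleftrightarrow> x \<in> space M \<and> (\<forall>w. convergent (\<lambda>n. birkhoff_avg (cyl w) n x))"

lemma AE_generic: "AE x in M. generic x"
proof -
  have "AE x in M. \<forall>w. convergent (\<lambda>n. birkhoff_avg (cyl w) n x)"
    unfolding AE_all_countable using birkhoff_convergent[OF cyl_measurable cyl_bound] by blast
  then show ?thesis by (auto simp: generic_def)
qed

lemma freq_measurable[measurable]: "freq w \<in> borel_measurable M"
  unfolding freq_def[abs_def] by measurable

lemma freq_tendsto: "generic x \<Longrightarrow> (\<lambda>n. birkhoff_avg (cyl w) n x) \<longlonglongrightarrow> freq w x"
  unfolding freq_def generic_def by (simp add: convergent_LIMSEQ_iff)

lemma birkhoff_avg_cyl_nonneg: "0 \<le> birkhoff_avg (cyl w) n x"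
  by (simp add: birkhoff_avg_def birkhoff_sum_def cyl_def sum_nonneg)

lemma freq_bounds:
  assumes "generic x"
  shows "0 \<le> freq w x" "freq w x \<le> 1"
proof -
  show "0 \<le> freq w x"
    by (rule LIMSEQ_le_const[OF freq_tendsto[OF assms]]) (use birkhoff_avg_cyl_nonneg in auto)
  show "freq w x \<le> 1"
    by (rule LIMSEQ_le_const2[OF freq_tendsto[OF assms]])
      (use abs_birkhoff_avg_le[of "cyl w" 1, OF cyl_bound] in \<open>auto dest: abs_le_D1\<close>)
qed

text \<open>The cylinders of the extensions of \<open>u\<close> partition that of \<open>u\<close>.
  With the version for prefixes below, the frequencies are the finite marginals of a shift-invariant
  measure on symbol sequences.\<close>

lemma sum_freq_append_right:
  assumes x: "generic x"
  shows "(\<Sum>v\<in>words r m. freq (u @ v) x) = freq u x"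
proof (rule LIMSEQ_unique)
  show "(\<lambda>n. \<Sum>v\<in>words r m. birkhoff_avg (cyl (u @ v)) n x) \<longlonglongrightarrow> (\<Sum>v\<in>words r m. freq (u @ v) x)"
    by (intro tendsto_sum freq_tendsto x)
  have "(\<Sum>v\<in>words r m. cyl (u @ v) y) = cyl u y" if "y \<in> space M" for y
    using sum_cyl[OF funpow_space[OF that, of "length u"], of "\<lambda>_. cyl u y" m]
    by (simp add: cyl_append)
  then have "(\<Sum>v\<in>words r m. birkhoff_avg (cyl (u @ v)) n x) = birkhoff_avg (cyl u) n x" for n
    using x unfolding generic_def by (subst birkhoff_avg_sum[symmetric]) (auto intro: birkhoff_avg_cong)
  then show "(\<lambda>n. \<Sum>v\<in>words r m. birkhoff_avg (cyl (u @ v)) n x) \<longlonglongrightarrow> freq u x"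
    using freq_tendsto[OF x] by simp
qed

text \<open>Summing out a prefix leaves the cylinder of \<open>v\<close> read l steps later;
  averages along the shifted orbit have the same limit.\<close>

lemma sum_freq_append_left:
  assumes x: "generic x"
  shows "(\<Sum>u\<in>words r l. freq (u @ v) x) = freq v x"
proof (rule LIMSEQ_unique)
  show "(\<lambda>n. \<Sum>u\<in>words r l. birkhoff_avg (cyl (u @ v)) n x) \<longlonglongrightarrow> (\<Sum>u\<in>words r l. freq (u @ v) x)"
    by (intro tendsto_sum freq_tendsto x)
  have "(\<Sum>u\<in>words r l. cyl (u @ v) y) = cyl v ((T ^^ l) y)" if "y \<in> space M" for y
  proof -
    have "(\<Sum>u\<in>words r l. cyl (u @ v) y) = (\<Sum>u\<in>words r l. cyl v ((T ^^ l) y) * cyl u y)"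
      by (intro sum.cong) (auto simp: cyl_append words_def)
    then show ?thesis using sum_cyl[OF that, of "\<lambda>_. cyl v ((T ^^ l) y)" l] by simp
  qed
  then have "(\<Sum>u\<in>words r l. birkhoff_avg (cyl (u @ v)) n x) = birkhoff_avg (\<lambda>y. cyl v ((T ^^ l) y)) n x" for n
    using x unfolding generic_def by (subst birkhoff_avg_sum[symmetric]) (auto intro: birkhoff_avg_cong)
  then show "(\<lambda>n. \<Sum>u\<in>words r l. birkhoff_avg (cyl (u @ v)) n x) \<longlonglongrightarrow> freq v x"
    unfolding birkhoff_avg_comp_funpow
    using birkhoff_avg_funpow_tendsto[of "cyl v" 1, OF cyl_bound freq_tendsto[OF x]] by simp
qed

lemma freq_Nil: "generic x \<Longrightarrow> freq [] x = 1"
proof (rule LIMSEQ_unique[OF freq_tendsto])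
  have "\<forall>\<^sub>F n in sequentially. birkhoff_avg (cyl []) n x = 1"
    by (rule eventually_sequentiallyI[of 1]) (simp add: birkhoff_avg_def birkhoff_sum_def cyl_def itin_def)
  then show "(\<lambda>n. birkhoff_avg (cyl []) n x) \<longlonglongrightarrow> 1" by (rule tendsto_eventually)
qed

lemma sum_freq: "generic x \<Longrightarrow> (\<Sum>w\<in>words r l. freq w x) = 1"
  using sum_freq_append_right[of x "[]" l] freq_Nil by simp

section \<open>Block entropies of the limiting frequencies\<close>

definition ent :: "nat \<Rightarrow> 'a \<Rightarrow> real" where
  "ent l x = (\<Sum>w\<in>words r l. - (freq w x * log 2 (freq w x)))"

lemma ent_measurable[measurable]: "ent l \<in> borel_measurable M"
  unfolding ent_def[abs_def] by measurable

lemma ent_bounds: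
  assumes "generic x"
  shows "0 \<le> ent l x" "ent l x \<le> real (card (words r l)) / ln 2"
proof -
  show "0 \<le> ent l x"
    unfolding ent_def by (intro sum_nonneg neg_mult_log_bounds freq_bounds assms)
  have "ent l x \<le> (\<Sum>w\<in>words r l. 1 / ln 2)"
    unfolding ent_def by (intro sum_mono neg_mult_log_bounds freq_bounds assms)
  then show "ent l x \<le> real (card (words r l)) / ln 2" by simp
qed

text \<open>Among joint distributions with given marginals the product has the largest entropy.
  Gibbs' inequality is applied with \<open>q\<close> the product of the marginals, which the two
  consistency lemmas identify as l-block and m-block frequencies.\<close>

lemma ent_subadditive:
  assumes x: "generic x"
  shows "ent (l + m) x \<le> ent l x + ent m x"
proof -
  define I where "I = words r l \<times> words r m"
  define p where "p = (\<lambda>(u, v). freq (u @ v) x)"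
  define q where "q = (\<lambda>(u, v). freq u x * freq v x)"
  \<comment> \<open>A joint frequency is one summand of each of its marginals. This gives the
    absolute continuity for Gibbs' inequality and allows splitting the logarithm of the
    product.\<close>
  have pos: "0 < freq u x" "0 < freq v x" if "u \<in> words r l" "v \<in> words r m" "0 < freq (u @ v) x" for u v
  proof -
    have "freq (u @ v) x \<le> freq u x"
      unfolding sum_freq_append_right[OF x, of u m, symmetric]
      by (rule member_le_sum) (use that freq_bounds[OF x] in auto)
    with that show "0 < freq u x" by simp
    have "freq (u @ v) x \<le> freq v x"
      unfolding sum_freq_append_left[OF x, of v l, symmetric]
      by (rule member_le_sum[where f = "\<lambda>u. freq (u @ v) x"]) (use that freq_bounds[OF x] in auto)
    with that show "0 < freq v x" by simp
  qed
  have p1: "sum p I = 1"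
    unfolding I_def p_def sum.cartesian_product[symmetric]
    by (simp add: sum_freq_append_right sum_freq x)
  have q1: "sum q I = 1"
    unfolding I_def q_def sum.cartesian_product[symmetric]
    by (simp add: sum_freq x flip: sum_distrib_left)
  have "ent (l + m) x = - (\<Sum>i\<in>I. p i * log 2 (p i))"
    unfolding ent_def I_def sum.reindex_bij_betw[OF bij_betw_append_words, symmetric] sum_negf
    by (simp add: p_def case_prod_beta)
  also have "\<dots> \<le> - (\<Sum>i\<in>I. p i * log 2 (q i)) + log 2 (sum q I)"
  proof (rule gibbs_inequality)
    show "finite I" by (simp add: I_def)
    show "sum p I = 1" by (rule p1)
  qed (use pos freq_bounds[OF x] in \<open>auto simp: I_def p_def q_def\<close>)
  also have "\<dots> = - (\<Sum>i\<in>I. p i * log 2 (q i))" by (simp add: q1)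
  also have "(\<Sum>i\<in>I. p i * log 2 (q i)) =
      (\<Sum>(u, v)\<in>I. freq (u @ v) x * log 2 (freq u x) + freq (u @ v) x * log 2 (freq v x))"
  proof (rule sum.cong, safe)
    fix u v assume "(u, v) \<in> I"
    then show "p (u, v) * log 2 (q (u, v)) =
        freq (u @ v) x * log 2 (freq u x) + freq (u @ v) x * log 2 (freq v x)"
      using pos[of u v] freq_bounds(1)[OF x, of "u @ v"]
      by (cases "freq (u @ v) x = 0") (auto simp: I_def p_def q_def log_mult distrib_left less_le)
  qed
  also have "\<dots> = (\<Sum>u\<in>words r l. \<Sum>v\<in>words r m. freq (u @ v) x * log 2 (freq u x)) +
      (\<Sum>u\<in>words r l. \<Sum>v\<in>words r m. freq (u @ v) x * log 2 (freq v x))"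
    by (simp add: I_def sum.distrib flip: sum.cartesian_product)
  also have "(\<Sum>u\<in>words r l. \<Sum>v\<in>words r m. freq (u @ v) x * log 2 (freq v x)) =
      (\<Sum>v\<in>words r m. \<Sum>u\<in>words r l. freq (u @ v) x * log 2 (freq v x))"
    by (rule sum.swap)
  finally show ?thesis
    by (simp add: ent_def sum_negf sum_freq_append_left sum_freq_append_right x flip: sum_distrib_right)
qed

lemma emp_entropy_tendsto:
  assumes x: "generic x"
  shows "(\<lambda>n. emp_entropy l (itinerary x n)) \<longlonglongrightarrow> ent l x / real l"
proof -
  have "(\<lambda>n. emp_freq (itinerary x n) w) \<longlonglongrightarrow> freq w x" for w
  proof (rule Lim_transform_eventually)
    have "filterlim (\<lambda>n. n - length w + 1) at_top sequentially"
      by (intro filterlim_at_top_mono[OF filterlim_minus_const_nat_at_top[of "length w"]]) auto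
    from filterlim_compose[OF freq_tendsto[OF x] this]
    show "(\<lambda>n. birkhoff_avg (cyl w) (n - length w + 1) x) \<longlonglongrightarrow> freq w x" .
    show "\<forall>\<^sub>F n in sequentially.
        birkhoff_avg (cyl w) (n - length w + 1) x = emp_freq (itinerary x n) w"
      by (rule eventually_sequentiallyI[of "length w"]) (simp add: emp_freq_itin)
  qed
  then have "(\<lambda>n. (\<Sum>w\<in>words r l. - (emp_freq (itinerary x n) w * log 2 (emp_freq (itinerary x n) w)))
      / real l) \<longlonglongrightarrow> ent l x / real l"
    unfolding ent_def divide_inverse
    by (intro tendsto_mult tendsto_const tendsto_sum tendsto_minus tendsto_mult_log emp_freq_bounds)
  then show ?thesis
    using x by (simp add: emp_entropy_eq_sum_words[OF set_itin] generic_def)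
qed

text \<open>By invariance every average over n \<ge> 1 steps already has integral
  \<open>cyl_prob w\<close>; bounded convergence passes this to the limit.\<close>

lemma integral_freq: "(\<integral>x. freq w x \<partial>M) = cyl_prob w"
proof (rule LIMSEQ_unique)
  show "(\<lambda>n. \<integral>x. birkhoff_avg (cyl w) n x \<partial>M) \<longlonglongrightarrow> (\<integral>x. freq w x \<partial>M)"
  proof (rule integral_dominated_convergence[where w = "\<lambda>_. 1"])
    show "AE x in M. (\<lambda>n. birkhoff_avg (cyl w) n x) \<longlonglongrightarrow> freq w x"
      using AE_generic by eventually_elim (rule freq_tendsto)
    show "AE x in M. norm (birkhoff_avg (cyl w) n x) \<le> 1" for n
      using abs_birkhoff_avg_le[of "cyl w" 1, OF cyl_bound] by simp
  qed auto
  have "\<forall>\<^sub>F n in sequentially. (\<integral>x. birkhoff_avg (cyl w) n x \<partial>M) = cyl_prob w"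
    by (rule eventually_sequentiallyI[of 1])
      (simp add: birkhoff_avg_def cyl_prob_def integral_birkhoff_sum[OF cyl_measurable cyl_bound])
  then show "(\<lambda>n. \<integral>x. birkhoff_avg (cyl w) n x \<partial>M) \<longlonglongrightarrow> cyl_prob w"
    by (rule tendsto_eventually)
qed

lemma integrable_ent: "integrable M (ent l)"
  by (rule integrable_const_bound[where B = "real (card (words r l)) / ln 2"])
    (use AE_generic ent_bounds in \<open>auto elim!: eventually_mono\<close>)

text \<open>Jensen's inequality, word by word. When the frequencies vary from point to point the
  inequality can be strict at fixed l; the final equalities show that the gap disappears after
  division by l.\<close>

lemma integral_ent_le: "(\<integral>x. ent l x \<partial>M) \<le> join_entropy M T r A l"
proof -
  have b: "AE x in M. 0 \<le> freq w x" "AE x in M. freq w x \<le> 1" for w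
    using AE_generic freq_bounds by (auto elim!: eventually_mono)
  have int: "integrable M (\<lambda>x. - (freq w x * log 2 (freq w x)))" for w
  proof (rule integrable_const_bound[where B = "1 / ln 2"])
    show "AE x in M. norm (- (freq w x * log 2 (freq w x))) \<le> 1 / ln 2"
      using b[of w]
    proof eventually_elim
      case (elim x)
      from neg_mult_log_bounds[OF this] show ?case by simp
    qed
  qed measurable
  have "(\<integral>x. ent l x \<partial>M) = (\<Sum>w\<in>words r l. \<integral>x. - (freq w x * log 2 (freq w x)) \<partial>M)"
    unfolding ent_def by (rule Bochner_Integration.integral_sum) (rule int)
  also have "\<dots> \<le> join_entropy M T r A l"
    unfolding join_entropy_eq
    by (rule sum_mono) (use integral_neg_mult_log_le[OF freq_measurable b] in \<open>simp add: integral_freq\<close>)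
  finally show ?thesis .
qed

section \<open>The empirical entropy rate\<close>

lemma H_hat_measurable[measurable]: "H_hat T r A \<in> borel_measurable M"
  unfolding H_hat_def[abs_def] by measurable

text \<open>At a generic point the inner upper limit is a true limit and the outer limit exists by
  Fekete's lemma, so \<open>lim\<close> has its intended meaning outside a null set.\<close>

lemma H_hat_tendsto:
  assumes x: "generic x"
  shows "(\<lambda>l. ent l x / real l) \<longlonglongrightarrow> H_hat T r A x" "1 \<le> l \<Longrightarrow> H_hat T r A x \<le> ent l x / real l"
proof -
  obtain L where L: "(\<lambda>l. ent l x / real l) \<longlonglongrightarrow> L" "\<And>l. 1 \<le> l \<Longrightarrow> L \<le> ent l x / real l"
    using fekete_subadditive[of "\<lambda>l. ent l x"] ent_bounds(1)[OF x] ent_subadditive[OF x] by metis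
  have "H_hat T r A x = lim (\<lambda>l. ent l x / real l)"
    unfolding H_hat_def real_limsup_def[symmetric]
    by (simp add: real_limsup_eq_lim[OF emp_entropy_tendsto[OF x]])
  also have "\<dots> = L" using L(1) by (rule limI)
  finally show "(\<lambda>l. ent l x / real l) \<longlonglongrightarrow> H_hat T r A x" "1 \<le> l \<Longrightarrow> H_hat T r A x \<le> ent l x / real l"
    using L by auto
qed

lemma H_hat_nonneg:
  assumes x: "generic x"
  shows "0 \<le> H_hat T r A x"
  by (rule LIMSEQ_le_const[OF H_hat_tendsto(1)[OF x]]) (use ent_bounds[OF x] in auto)

lemma integrable_H_hat: "integrable M (H_hat T r A)"
proof (rule integrable_const_bound[where B = "real (card (words r 1)) / ln 2"])
  show "AE x in M. norm (H_hat T r A x) \<le> real (card (words r 1)) / ln 2"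
    using AE_generic
  proof eventually_elim
    case (elim x)
    from H_hat_nonneg[OF this] H_hat_tendsto(2)[OF this, of 1] ent_bounds(2)[OF this, of 1]
    show ?case by simp
  qed
qed measurable

lemma integral_H_hat_le:
  assumes "1 \<le> l"
  shows "(\<integral>x. H_hat T r A x \<partial>M) \<le> join_entropy M T r A l / real l"
proof -
  have "(\<integral>x. H_hat T r A x \<partial>M) \<le> (\<integral>x. ent l x / real l \<partial>M)"
    by (rule integral_mono_AE)
      (use integrable_H_hat integrable_ent AE_generic H_hat_tendsto(2)[OF _ assms]
        in \<open>auto elim!: eventually_mono\<close>)
  also have "\<dots> \<le> join_entropy M T r A l / real l"
    using integral_ent_le[of l] by (simp add: divide_right_mono)
  finally show ?thesis .
qed

end

section \<open>Complexity rates\<close>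

context symbolic_system begin

text \<open>Covers both complexities: \<open>F\<close> will be the code length under
  \<open>Z\<close> or \<open>AIC C\<close>.\<close>

definition rate :: "(nat list \<Rightarrow> nat) \<Rightarrow> 'a \<Rightarrow> real" where
  "rate F x = real_limsup (\<lambda>n. real (F (itinerary x n)) / real n)"

lemma rate_measurable[measurable]: "rate F \<in> borel_measurable M"
  unfolding rate_def[abs_def] by measurable

context
  fixes F :: "nat list \<Rightarrow> nat" and B :: real
  assumes F: "\<And>s. set s \<subseteq> {1..r} \<Longrightarrow> real (F s) / real (length s) \<le> B"
begin

lemma rate_seq_bounds:
  assumes "x \<in> space M"
  shows "0 \<le> real (F (itinerary x n)) / real n" "real (F (itinerary x n)) / real n \<le> B"
  using F[OF set_itin[OF assms], of n] by simp_all

lemma rate_bounds: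
  assumes "x \<in> space M"
  shows "0 \<le> rate F x" "rate F x \<le> B"
  unfolding rate_def by (rule real_limsup_bounds[where B = B]; rule rate_seq_bounds[OF assms])+

lemma integrable_rate: "integrable M (rate F)"
  by (rule integrable_const_bound[where B = B]) (use rate_bounds in \<open>auto intro!: AE_I2\<close>)

text \<open>Gibbs' inequality with weights 2^(-F): the cross entropy is the mean of
  \<open>F\<close>, and \<open>kraft\<close> bounds the logarithm of the total weight. For
  \<open>AIC\<close> the assumption \<open>kraft\<close> is \<open>sum_AIC_le\<close>.\<close>

lemma join_entropy_le_mean_rate:
  assumes kraft: "\<And>S N. finite S \<Longrightarrow> (\<And>s. s \<in> S \<Longrightarrow> F s \<le> N) \<Longrightarrow>
      (\<Sum>s\<in>S. 2 powr (- real (F s))) \<le> real N + 1"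
    and n: "1 \<le> n"
  shows "join_entropy M T r A n / real n \<le>
      (\<integral>x. real (F (itinerary x n)) / real n \<partial>M) + log 2 (B * real n + 1) / real n"
proof -
  have FB: "real (F s) \<le> B * real n" if "s \<in> words r n" for s
    using F[of s] that n by (auto simp: words_def pos_divide_le_eq)
  define N where "N = nat \<lfloor>B * real n\<rfloor>"
  have N: "F s \<le> N" if "s \<in> words r n" for s
    using FB[OF that] unfolding N_def by (simp add: le_nat_floor)
  obtain x where "x \<in> space M" using not_empty by blast
  \<comment> \<open>At the empty string the quotient is 0, because division by zero yields
    0.\<close>
  have "0 \<le> B" using F[of "[]"] by simp
  have p1: "sum cyl_prob (words r n) = 1"
    using sum_cyl_prob[of "\<lambda>_. 1" n] by (simp add: prob_space)
  have "join_entropy M T r A n = - (\<Sum>w\<in>words r n. cyl_prob w * log 2 (cyl_prob w))"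
    by (simp add: join_entropy_eq sum_negf)
  also have "\<dots> \<le> - (\<Sum>w\<in>words r n. cyl_prob w * log 2 (2 powr (- real (F w)))) +
      log 2 (\<Sum>w\<in>words r n. 2 powr (- real (F w)))"
    by (rule gibbs_inequality) (auto simp: cyl_prob_nonneg p1)
  also have "- (\<Sum>w\<in>words r n. cyl_prob w * log 2 (2 powr (- real (F w)))) =
      (\<integral>x. real (F (itinerary x n)) \<partial>M)"
    using sum_cyl_prob[of "\<lambda>w. real (F w)" n] by (simp add: sum_negf mult.commute)
  also have "log 2 (\<Sum>w\<in>words r n. 2 powr (- real (F w))) \<le> log 2 (B * real n + 1)"
  proof (subst log_le_cancel_iff)
    have "(\<Sum>w\<in>words r n. 2 powr (- real (F w))) \<le> real N + 1"
      by (rule kraft) (auto intro: N)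
    also have "real N \<le> B * real n" unfolding N_def using \<open>0 \<le> B\<close> by simp
    finally show "(\<Sum>w\<in>words r n. 2 powr (- real (F w))) \<le> B * real n + 1" by simp
    have "words r n \<noteq> {}" using itin_in_words[OF \<open>x \<in> space M\<close>] by blast
    then show "0 < (\<Sum>w\<in>words r n. 2 powr (- real (F w)))" by (intro sum_pos) auto
    show "0 < B * real n + 1" using \<open>0 \<le> B\<close> by (simp add: add_nonneg_pos)
  qed simp
  finally have "join_entropy M T r A n / real n \<le>
      ((\<integral>x. real (F (itinerary x n)) \<partial>M) + log 2 (B * real n + 1)) / real n"
    by (intro divide_right_mono) auto
  then show ?thesis by (simp add: add_divide_distrib)
qed

lemma join_entropy_eventually_le_rate:
  assumes kraft: "\<And>S N. finite S \<Longrightarrow> (\<And>s. s \<in> S \<Longrightarrow> F s \<le> N) \<Longrightarrow>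
      (\<Sum>s\<in>S. 2 powr (- real (F s))) \<le> real N + 1"
    and "0 < e"
  shows "\<forall>\<^sub>F n in sequentially. join_entropy M T r A n / real n \<le> (\<integral>x. rate F x \<partial>M) + e"
proof -
  have "0 \<le> B" using F[of "[]"] by simp
  have "(\<lambda>n. log 2 (B * real n + 1) / real n) \<longlonglongrightarrow> 0"
  proof (cases "B = 0")
    case False
    with \<open>0 \<le> B\<close> have "0 < B" by simp
    then show ?thesis by real_asymp
  qed simp
  then have "\<forall>\<^sub>F n in sequentially. log 2 (B * real n + 1) / real n < e / 2"
    using \<open>0 < e\<close> by (intro order_tendstoD(2)) auto
  moreover have "\<forall>\<^sub>F n in sequentially.
      (\<integral>x. real (F (itinerary x n)) / real n \<partial>M) \<le> (\<integral>x. rate F x \<partial>M) + e / 2"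
    unfolding rate_def
    by (rule integral_le_real_limsup[where B = B]) (use rate_seq_bounds \<open>0 < e\<close> in auto)
  ultimately show ?thesis
    using eventually_ge_at_top[of "1::nat"]
  proof eventually_elim
    case (elim n)
    have "join_entropy M T r A n / real n \<le>
        (\<integral>x. real (F (itinerary x n)) / real n \<partial>M) + log 2 (B * real n + 1) / real n"
      by (rule join_entropy_le_mean_rate[OF kraft]) (use elim in auto)
    with elim show ?case by linarith
  qed
qed

end

lemma rate_mono:
  assumes F: "\<And>s. set s \<subseteq> {1..r} \<Longrightarrow> real (F s) / real (length s) \<le> B"
    and G: "\<And>s. set s \<subseteq> {1..r} \<Longrightarrow> real (G s) / real (length s) \<le> B'"
    and le: "\<And>s. F s \<le> G s + c" and x: "x \<in> space M"
  shows "rate F x \<le> rate G x"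
  unfolding rate_def
proof (rule real_limsup_mono[where d = "\<lambda>n. real c / real n" and B = B and B' = B'])
  fix n
  have "real (F (itinerary x n)) / real n \<le> real (G (itinerary x n) + c) / real n"
    using le by (intro divide_right_mono) (simp_all flip: of_nat_add)
  then show "real (F (itinerary x n)) / real n \<le> real c / real n + real (G (itinerary x n)) / real n"
    by (simp add: add_divide_distrib)
qed (use rate_seq_bounds[OF F x] rate_seq_bounds[OF G x] lim_const_over_n in auto)

text \<open>The error function may depend on l, so the limit in n is taken at fixed l, where the
  error vanishes, and only afterwards the limit in l.\<close>

lemma rate_le_H_hat:
  assumes B: "\<And>s. set s \<subseteq> {1..r} \<Longrightarrow> real (F s) / real (length s) \<le> B"
    and opt: "\<And>l. 1 \<le> l \<Longrightarrow> \<exists>f :: nat \<Rightarrow> real. f \<in> o(\<lambda>n. real n) \<and> (\<forall>s. set s \<subseteq> {1..r} \<longrightarrow>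
        real (F s) / real (length s) \<le> emp_entropy l s + f (length s) / real (length s))"
    and x: "generic x"
  shows "rate F x \<le> H_hat T r A x"
proof (rule LIMSEQ_le_const[OF H_hat_tendsto(1)[OF x]], intro exI allI impI)
  fix l :: nat assume "1 \<le> l"
  have xM: "x \<in> space M" using x by (simp add: generic_def)
  obtain f :: "nat \<Rightarrow> real" where f: "f \<in> o(\<lambda>n. real n)"
    and le: "\<And>s. set s \<subseteq> {1..r} \<Longrightarrow>
      real (F s) / real (length s) \<le> emp_entropy l s + f (length s) / real (length s)"
    using opt[OF \<open>1 \<le> l\<close>] by blast
  have f0: "(\<lambda>n. f n / real n) \<longlonglongrightarrow> 0" using smalloD_tendsto[OF f] .
  have "rate F x \<le> real_limsup (\<lambda>n. emp_entropy l (itinerary x n))"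
    unfolding rate_def
  proof (rule real_limsup_mono[OF _ _ _ _ _ f0])
    show "real (F (itinerary x n)) / real n \<le> f n / real n + emp_entropy l (itinerary x n)" for n
      using le[OF set_itin[OF xM], of n] by simp
  qed (use rate_seq_bounds[OF B xM] emp_entropy_bounds[OF set_itin[OF xM]] in auto)
  also have "\<dots> = ent l x / real l" by (rule real_limsup_eq_lim[OF emp_entropy_tendsto[OF x]])
  finally show "rate F x \<le> ent l x / real l" .
qed

end

text \<open>Optimality at block length 1: the 1-block entropy is bounded for a fixed alphabet, and
  f(n) / n is bounded because it converges.\<close>

lemma optimal_coding_rate_bounded:
  assumes "optimal_coding Z"
  obtains B where "\<And>s. set s \<subseteq> {1..r} \<Longrightarrow> real (length (Z s)) / real (length s) \<le> B"
proof -
  obtain f :: "nat \<Rightarrow> real" where f: "f \<in> o(\<lambda>n. real n)"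
    and le: "\<And>s. set s \<subseteq> {1..r} \<Longrightarrow>
      real (length (Z s)) / real (length s) \<le> emp_entropy 1 s + f (length s) / real (length s)"
    using assms unfolding optimal_coding_def by blast
  have "Bseq (\<lambda>n. f n / real n)"
    using smalloD_tendsto[OF f] by (intro convergent_imp_Bseq convergentI)
  then obtain K where K: "\<And>n. norm (f n / real n) \<le> K" by (auto simp: Bseq_def)
  have "real (length (Z s)) / real (length s) \<le> real (card (words r 1)) / ln 2 + K"
    if "set s \<subseteq> {1..r}" for s
    using le[OF that] emp_entropy_bounds(2)[OF that, of 1] abs_le_D1[OF K[of "length s", unfolded real_norm_def]]
    by linarith
  then show ?thesis using that by blast
qed

theorem theorem4p5:
  fixes T :: "'a::metric_space \<Rightarrow> 'a" and M :: "'a measure"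
    and Z :: "nat list \<Rightarrow> bool list" and C :: "bool list \<Rightarrow> nat list option"
    and r :: nat and A :: "nat \<Rightarrow> 'a set"
  assumes "compact (UNIV :: 'a set)"
    and "continuous_on UNIV T"
    and "sets M = sets borel"
    and "prob_space M"
    and "T \<in> M \<rightarrow>\<^sub>M M"
    and "\<forall>B\<in>sets M. emeasure M (T -` B \<inter> space M) = emeasure M B"
    and "optimal_coding Z"
    and "universal_machine C"
    and "meas_partition M r A"
  shows "integrable M (K_Z Z T r A) \<and> integrable M (H_hat T r A) \<and> integrable M (K_AIC C T r A)
    \<and> KS_entropy M T r A = (\<integral>x. K_Z Z T r A x \<partial>M)
    \<and> (\<integral>x. K_Z Z T r A x \<partial>M) = (\<integral>x. H_hat T r A x \<partial>M)
    \<and> (\<integral>x. H_hat T r A x \<partial>M) = (\<integral>x. K_AIC C T r A x \<partial>M)"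
proof -
  have "distr M M T = M"
    using assms(5,6) by (intro measure_eqI) (auto simp: emeasure_distr)
  then interpret symbolic_system M T r A
    using assms(4,5,9) by (simp add: symbolic_system_def symbolic_system_axioms_def
      measure_preserving_system_def measure_preserving_system_axioms_def)
  have KZ: "K_Z Z T r A = rate (\<lambda>s. length (Z s))" and KC: "K_AIC C T r A = rate (AIC C)"
    by (auto simp: K_Z_def K_AIC_def rate_def real_limsup_def fun_eq_iff)
  obtain B where B: "\<And>s. set s \<subseteq> {1..r} \<Longrightarrow> real (length (Z s)) / real (length s) \<le> B"
    using optimal_coding_rate_bounded[OF assms(7)] by blast
  have "reversible_coding Z" using assms(7) by (simp add: optimal_coding_def)
  then obtain c where c: "\<And>s. AIC C s \<le> length (Z s) + c" "\<And>s. \<exists>P. C P = Some s"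
    using AIC_le_length_coding[OF _ assms(8)] by blast
  have BC: "real (AIC C s) / real (length s) \<le> B + real c" if "set s \<subseteq> {1..r}" for s
  proof -
    have "real (AIC C s) / real (length s) \<le> real (length (Z s) + c) / real (length s)"
      by (intro divide_right_mono of_nat_mono c) simp
    also have "\<dots> = real (length (Z s)) / real (length s) + real c / real (length s)"
      by (simp add: add_divide_distrib)
    \<comment> \<open>The overhead c / |s| is at most c for nonempty s, and for the empty string it
      is 0 by the convention on division.\<close>
    also have "\<dots> \<le> B + real c"
      by (intro add_mono B that) (cases s; simp add: divide_le_eq algebra_simps)
    finally show ?thesis .
  qed
  have int: "integrable M (rate (\<lambda>s. length (Z s)))" "integrable M (rate (AIC C))"
    by (rule integrable_rate[OF B], simp) (rule integrable_rate[OF BC], simp)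
  define h where "h = (\<integral>x. rate (AIC C) x \<partial>M)"
  have AIC_le: "h \<le> (\<integral>x. rate (\<lambda>s. length (Z s)) x \<partial>M)"
    unfolding h_def using int by (intro integral_mono rate_mono[OF BC B c(1)]) auto
  have Z_le: "(\<integral>x. rate (\<lambda>s. length (Z s)) x \<partial>M) \<le> (\<integral>x. H_hat T r A x \<partial>M)"
  proof (rule integral_mono_AE)
    show "AE x in M. rate (\<lambda>s. length (Z s)) x \<le> H_hat T r A x"
      using AE_generic
    proof eventually_elim
      case (elim x)
      show ?case
        by (rule rate_le_H_hat[OF B _ elim])
          (use assms(7) in \<open>auto simp: optimal_coding_def\<close>)
    qed
  qed (use int integrable_H_hat in auto)
  have up: "\<forall>\<^sub>F n in sequentially. join_entropy M T r A n / real n \<le> h + e" if "0 < e" for e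
    unfolding h_def
    by (rule join_entropy_eventually_le_rate[OF BC _ that]) (auto intro: sum_AIC_le c(2))
  have H_le: "(\<integral>x. H_hat T r A x \<partial>M) \<le> h"
  proof (rule field_le_epsilon)
    fix e :: real assume "0 < e"
    \<comment> \<open>The lower bound on the entropy of the join holds at each index, so a single
      index satisfying the upper bound suffices.\<close>
    from eventually_happens[OF eventually_conj[OF up[OF this] eventually_ge_at_top[of 1]]]
    obtain n where "join_entropy M T r A n / real n \<le> h + e" "1 \<le> n" by auto
    with integral_H_hat_le[of n] show "(\<integral>x. H_hat T r A x \<partial>M) \<le> h + e" by linarith
  qed
  have "(\<lambda>n. join_entropy M T r A n / real n) \<longlonglongrightarrow> h"
  proof (rule order_tendstoI)
    fix a assume "a < h"
    \<comment> \<open>Running through the chain of inequalities gives a lower bound free of error at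
      every n \<ge> 1; with \<open>up\<close> it yields convergence of the quotients.\<close>
    have "h \<le> join_entropy M T r A n / real n" if "1 \<le> n" for n
      using integral_H_hat_le[OF that] AIC_le Z_le by linarith
    with \<open>a < h\<close> show "\<forall>\<^sub>F n in sequentially. a < join_entropy M T r A n / real n"
      by (intro eventually_sequentiallyI[of 1]) (auto intro: less_le_trans)
  next
    fix a assume "h < a"
    then have "0 < (a - h) / 2" by simp
    from up[OF this] show "\<forall>\<^sub>F n in sequentially. join_entropy M T r A n / real n < a"
      by eventually_elim (use \<open>h < a\<close> in \<open>simp add: field_simps\<close>)
  qed
  then have "KS_entropy M T r A = h" unfolding KS_entropy_def by (rule limI)
  then show ?thesis
    unfolding KZ KC using int integrable_H_hat AIC_le Z_le H_le by (auto simp: h_def)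
qed

end
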